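(* Let $a\ge 1$, $b\ge 0$ be integers and let $\nu=NE^{\nu_1}NE^{\nu_2}\cdots NE^{\nu_a}$ be a lattice path from $(0,0)$ to $(b,a)$. The planar-framed triangulation of $\mathcal{F}_{\mathrm{car}(\nu)}$ is a regular unimodular triangulation whose dual graph is (isomorphic, as an undirected graph, to) the Hasse diagram of the principal order ideal $I(\nu)$ in Young's lattice $Y$.
   Context: Lattice paths use north steps $N=(0,1)$ and east steps $E=(1,0)$. Here $\nu=NE^{\nu_1}\cdots NE^{\nu_a}$ with integers $\nu_i\ge 0$ and $\sum_i \nu_i=b$. **Graph and polytope.** The $\nu$-caracol graph $\mathrm{car}(\nu)$ is the directed multigraph on the vertex set $\{1,\dots,a+3\}$, all edges $(i,j)$ directed from $i$ to $j$ with $i<j$, having exactly these edges: $\nu_i$ copies of $(1,i+2)$ for $i=1,\dots,a$; one edge $(i,a+3)$ for each $i=2,\dots,a+1$; one edge $(i,i+1)$ for each $i=1,\dots,a+2$. Write $n+1=a+3$ and let $m=2a+b+2$ be the number of edges. The flow polytope $\mathcal{F}_{\mathrm{car}(\nu)}\subset\mathbb{R}^m$ is the set of nonnegative tuples $(x_e)_e$ with $\sum_{e\in \mathrm{out}(1)}x_e=1$ and $\sum_{e\in\mathrm{out}(j)}x_e=\sum_{e\in\mathrm{in}(j)}x_e$ for $j=2,\dots,n$. Its dimension is $a+b$. A route is a directed path from $1$ to $n+1$; the vertices of $\mathcal{F}_{\mathrm{car}(\nu)}$ are the indicator vectors of routes. **Framings and framed triangulations.** Inner vertices are $2,\dots,n$.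 A framing is a choice, at every inner vertex $i$, of linear orders $\prec_{\mathrm{in}(i)}$ and $\prec_{\mathrm{out}(i)}$ on the sets of incoming and outgoing edges at $i$. For distinct directed paths $P,Q$ from $1$ to $i$, let $j\le i$ be the smallest vertex after which $P$ and $Q$ coincide, and put $P\prec Q$ iff the edge of $P$ entering $j$ precedes the edge of $Q$ entering $j$ in $\prec_{\mathrm{in}(j)}$. For distinct directed paths $P,Q$ from $i$ to $n+1$, let $j\ge i$ be the largest vertex before which they coincide, and put $P\prec Q$ iff the edge of $P$ leaving $j$ precedes the edge of $Q$ leaving $j$ in $\prec_{\mathrm{out}(j)}$. For a route $R$ through $i$, $Ri$ and $iR$ denote the subpaths of $R$ ending, respectively beginning, at $i$. Routes $R,Q$ through $i$ are coherent at $i$ if $Ri,Qi$ are ordered the same as $iR,iQ$ (i.e. it is not the case that one of the pairs is strictly ordered one way and the other pair strictly ordered the opposite way; equal subpaths cause no conflict). Routes are coherent if they are coherent at every common inner vertex. A clique is a set of mutually coherent routes; for a maximal clique $C$, $\Delta_C$ is the convex hull of the vertices of the flow polytope corresponding to routes in $C$. The framed triangulation is the one with top-dimensional simplices $\{\Delta_C : C \text{ a maximal clique}\}$. **Planar framing.** Embed $\mathrm{car}(\nu)$ in the plane with the path $1,2,\dots,n+1$ along the $x$-axis (left to right), the edges $(1,i+2)$, $1\le i\le a$, above the axis (parallel copies labelled $1,2,\dots$ from top to bottom), and the edges $(i,n+1)$, $2\le i\le a+1$, below the axis. In the planar framing, incoming edges and outgoing edges at each inner vertex are each ordered from top to bottom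 in this embedding. Explicitly: the incoming edges at $i$ are ordered as the copies of $(1,i)$ above the axis by increasing label, followed by $(i-1,i)$; the outgoing edges at $i$ are ordered as $(i,i+1)$ followed by $(i,n+1)$ if the latter is a different edge. The planar-framed triangulation is the framed triangulation for this framing. **Dual graph.** The dual graph of a triangulation has the top-dimensional simplices as vertices, with edges between simplices sharing a common facet. A triangulation by lattice simplices is unimodular if each top-dimensional simplex is unimodular with respect to the lattice $\mathbb{Z}^m\cap\mathrm{aff}(\mathcal{F}_{\mathrm{car}(\nu)})$; "regular" has its usual meaning. **Order ideal.** Young's lattice $Y$ is the poset of integer partitions, with $\lambda\lessdot\lambda'$ if $\lambda$ is obtained from $\lambda'$ by removing one corner box of its Young diagram. The path $\nu$ determines the partition $\lambda(\nu)=(\lambda_1,\dots,\lambda_a)$ with $\lambda_k=b-\sum_{i=a-k+1}^{a}\nu_i$ (the region of the rectangle from $(0,0)$ to $(b,a)$ lying northwest of $\nu$). $I(\nu)$ is the principal order ideal $\{\lambda\in Y:\lambda\le\lambda(\nu)\}$. *)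

theory Defs
  imports "HOL-Analysis.Analysis"
begin

section \<open>Framed graphs and flow polytopes\<close>

text \<open>
  A directed multigraph on the vertex set \<open>{1..sink}\<close> whose edges are all the elements of the type
  \<^typ>\<open>'e\<close>, with edges directed from smaller to larger vertices, together with a framing:
  \<open>in_less G i\<close> and \<open>out_less G i\<close> are strict linear orders on the edges entering, respectively
  leaving, the inner vertex \<open>i\<close>. Flows are vectors in \<^typ>\<open>real^'e\<close>.
\<close>

record 'e framed_graph =
  sink :: nat
  tail :: "'e \<Rightarrow> nat"
  head :: "'e \<Rightarrow> nat"
  in_less :: "nat \<Rightarrow> 'e \<Rightarrow> 'e \<Rightarrow> bool"
  out_less :: "nat \<Rightarrow> 'e \<Rightarrow> 'e \<Rightarrow> bool"

definition inner_vertices :: "'e framed_graph \<Rightarrow> nat set" where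
  "inner_vertices G = {2..<sink G}"

definition flow_polytope :: "('e::finite) framed_graph \<Rightarrow> (real^'e) set" where
  "flow_polytope G =
    {x. (\<forall>e. 0 \<le> x $ e) \<and>
        (\<Sum>e | tail G e = 1. x $ e) = 1 \<and>
        (\<forall>j\<in>inner_vertices G. (\<Sum>e | tail G e = j. x $ e) = (\<Sum>e | head G e = j. x $ e))}"

fun dipath :: "'e framed_graph \<Rightarrow> nat \<Rightarrow> 'e list \<Rightarrow> nat \<Rightarrow> bool" where
  "dipath G i [] j \<longleftrightarrow> i = j"
| "dipath G i (e # es) j \<longleftrightarrow> tail G e = i \<and> dipath G (head G e) es j"

definition routes :: "'e framed_graph \<Rightarrow> 'e list set" where
  "routes G = {R. dipath G 1 R (sink G)}"

definition indicator_vec :: "('e::finite) list \<Rightarrow> real^'e" where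
  "indicator_vec R = (\<chi> e. if e \<in> set R then 1 else 0)"

text \<open>
  Vertices increase along a path, so the part of a route \<open>R\<close> ending at \<open>i\<close> consists of the edges with
  head at most \<open>i\<close>.
\<close>

definition passes_through :: "'e framed_graph \<Rightarrow> 'e list \<Rightarrow> nat \<Rightarrow> bool" where
  "passes_through G R i \<longleftrightarrow> i \<in> tail G ` set R \<union> head G ` set R"

definition path_to :: "'e framed_graph \<Rightarrow> nat \<Rightarrow> 'e list \<Rightarrow> 'e list" where
  "path_to G i R = takeWhile (\<lambda>e. head G e \<le> i) R"

definition path_from :: "'e framed_graph \<Rightarrow> nat \<Rightarrow> 'e list \<Rightarrow> 'e list" where
  "path_from G i R = dropWhile (\<lambda>e. head G e \<le> i) R"

text \<open>
  In the next two definitions \<open>S\<close> is the maximal common part of the two paths at their common end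
  (respectively start), and \<open>e\<close>, \<open>f\<close> are the edges at which they meet (respectively separate).
\<close>

definition incoming_path_less :: "'e framed_graph \<Rightarrow> 'e list \<Rightarrow> 'e list \<Rightarrow> bool" where
  "incoming_path_less G P Q \<longleftrightarrow>
    (\<exists>P' Q' e f S. P = P' @ e # S \<and> Q = Q' @ f # S \<and> e \<noteq> f \<and>
       head G e = head G f \<and> in_less G (head G e) e f)"

definition outgoing_path_less :: "'e framed_graph \<Rightarrow> 'e list \<Rightarrow> 'e list \<Rightarrow> bool" where
  "outgoing_path_less G P Q \<longleftrightarrow>
    (\<exists>P' Q' e f S. P = S @ e # P' \<and> Q = S @ f # Q' \<and> e \<noteq> f \<and>
       tail G e = tail G f \<and> out_less G (tail G e) e f)"

definition coherent_at :: "'e framed_graph \<Rightarrow> nat \<Rightarrow> 'e list \<Rightarrow> 'e list \<Rightarrow> bool" where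
  "coherent_at G i R Q \<longleftrightarrow>
    \<not> (incoming_path_less G (path_to G i R) (path_to G i Q) \<and>
       outgoing_path_less G (path_from G i Q) (path_from G i R)) \<and>
    \<not> (incoming_path_less G (path_to G i Q) (path_to G i R) \<and>
       outgoing_path_less G (path_from G i R) (path_from G i Q))"

definition coherent :: "'e framed_graph \<Rightarrow> 'e list \<Rightarrow> 'e list \<Rightarrow> bool" where
  "coherent G R Q \<longleftrightarrow>
    (\<forall>i\<in>inner_vertices G. passes_through G R i \<and> passes_through G Q i \<longrightarrow> coherent_at G i R Q)"

definition clique :: "'e framed_graph \<Rightarrow> 'e list set \<Rightarrow> bool" where
  "clique G C \<longleftrightarrow> C \<subseteq> routes G \<and> (\<forall>R\<in>C. \<forall>Q\<in>C. coherent G R Q)"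

definition maximal_clique :: "'e framed_graph \<Rightarrow> 'e list set \<Rightarrow> bool" where
  "maximal_clique G C \<longleftrightarrow> clique G C \<and> (\<forall>D. clique G D \<and> C \<subseteq> D \<longrightarrow> D = C)"

definition clique_simplex :: "('e::finite) list set \<Rightarrow> (real^'e) set" where
  "clique_simplex C = convex hull (indicator_vec ` C)"

text \<open>The framed triangulation as a full complex: all faces (including the empty one) of the cells.\<close>

definition framed_triangulation :: "('e::finite) framed_graph \<Rightarrow> (real^'e) set set" where
  "framed_triangulation G = {F. \<exists>C. maximal_clique G C \<and> F face_of clique_simplex C}"

section \<open>Triangulations of polytopes\<close>

definition triangulation_of :: "('a::euclidean_space) set set \<Rightarrow> 'a set \<Rightarrow> bool" where
  "triangulation_of T P \<longleftrightarrow> simplicial_complex T \<and> \<Union>T = P"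

definition top_simplices :: "('a::euclidean_space) set set \<Rightarrow> 'a set \<Rightarrow> 'a set set" where
  "top_simplices T P = {S \<in> T. aff_dim S = aff_dim P}"

text \<open>
  A lower face of a polytope in \<open>'a \<times> real\<close> is an exposed face cut out by a non-vertical hyperplane
  \<open>t = c \<bullet> x - d\<close> that lies weakly below the polytope.
\<close>

definition lower_face :: "('a::euclidean_space \<times> real) set \<Rightarrow> ('a \<times> real) set \<Rightarrow> bool" where
  "lower_face Q F \<longleftrightarrow>
    (\<exists>c d. (\<forall>(x, t)\<in>Q. c \<bullet> x - d \<le> t) \<and> F = {(x, t) \<in> Q. t = c \<bullet> x - d})"

definition regular_triangulation :: "('a::euclidean_space) set set \<Rightarrow> bool" where
  "regular_triangulation T \<longleftrightarrow>
    (\<exists>\<omega> :: 'a \<Rightarrow> real.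
      T = {fst ` F | F. lower_face (convex hull {(v, \<omega> v) | v. {v} \<in> T}) F})"

definition integer_points :: "(real^'e) set" where
  "integer_points = {x. \<forall>e. x $ e \<in> \<int>}"

text \<open>
  A simplex is unimodular with respect to an affine lattice \<open>L\<close> if its vertices form an affine
  \<open>\<int>\<close>-basis of \<open>L\<close>.
\<close>

definition unimodular_simplex :: "('a::euclidean_space) set \<Rightarrow> 'a set \<Rightarrow> bool" where
  "unimodular_simplex L S \<longleftrightarrow>
    (\<exists>V. finite V \<and> \<not> affine_dependent V \<and> S = convex hull V \<and>
       L = {\<Sum>v\<in>V. of_int (c v) *\<^sub>R v | c :: 'a \<Rightarrow> int. (\<Sum>v\<in>V. c v) = 1})"

definition unimodular_triangulation :: "(real^'e::finite) set set \<Rightarrow> (real^'e) set \<Rightarrow> bool" where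
  "unimodular_triangulation T P \<longleftrightarrow>
    (\<forall>S\<in>top_simplices T P. unimodular_simplex (integer_points \<inter> affine hull P) S)"

section \<open>Undirected graphs\<close>

text \<open>A simple graph is a pair of a vertex set and a set of two-element edges.\<close>

type_synonym 'a ugraph = "'a set \<times> 'a set set"

definition ugraph_iso :: "'a ugraph \<Rightarrow> 'b ugraph \<Rightarrow> bool" where
  "ugraph_iso G H \<longleftrightarrow> (\<exists>f. bij_betw f (fst G) (fst H) \<and> (`) f ` snd G = snd H)"

definition dual_graph :: "('a::euclidean_space) set set \<Rightarrow> 'a set \<Rightarrow> 'a set ugraph" where
  "dual_graph T P =
    (top_simplices T P,
     {{S, S'} | S S'. S \<in> top_simplices T P \<and> S' \<in> top_simplices T P \<and> S \<noteq> S' \<and>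
        (\<exists>F. F facet_of S \<and> F facet_of S')})"

section \<open>Young's lattice\<close>

text \<open>A partition is a finitely supported weakly decreasing sequence; the first part has index \<open>0\<close>.\<close>

definition partitions :: "(nat \<Rightarrow> nat) set" where
  "partitions = {p. antimono p \<and> finite {k. p k \<noteq> 0}}"

definition young_cover :: "(nat \<Rightarrow> nat) \<Rightarrow> (nat \<Rightarrow> nat) \<Rightarrow> bool" where
  "young_cover p q \<longleftrightarrow>
    q \<in> partitions \<and> (\<exists>k. q (Suc k) < q k \<and> p = q(k := q k - 1))"

definition young_le :: "(nat \<Rightarrow> nat) \<Rightarrow> (nat \<Rightarrow> nat) \<Rightarrow> bool" where
  "young_le = young_cover\<^sup>*\<^sup>*"

definition young_ideal :: "(nat \<Rightarrow> nat) \<Rightarrow> (nat \<Rightarrow> nat) set" where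
  "young_ideal q = {p \<in> partitions. young_le p q}"

definition hasse_diagram :: "(nat \<Rightarrow> nat) set \<Rightarrow> (nat \<Rightarrow> nat) ugraph" where
  "hasse_diagram I = (I, {{p, q} | p q. p \<in> I \<and> q \<in> I \<and> young_cover p q})"

section \<open>The caracol graph of a lattice path\<close>

text \<open>
  The path \<open>N E\<^sup>\<nu>\<^sup>1 \<dots> N E\<^sup>\<nu>\<^sup>a\<close> is given by the list of its exponents, so that the \<open>i\<close>-th exponent is
  \<open>\<nu> ! (i - 1)\<close>. The value of \<open>path_partition \<nu>\<close> at \<open>k\<close> is the part with number \<open>k + 1\<close>, the length of the
  \<open>(k + 1)\<close>-st row from the top of the region northwest of the path.
\<close>

definition path_partition :: "nat list \<Rightarrow> nat \<Rightarrow> nat" where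
  "path_partition \<nu> k =
    (if k < length \<nu> then sum_list \<nu> - (\<Sum>i = length \<nu> - k..length \<nu>. \<nu> ! (i - 1)) else 0)"

text \<open>
  With \<open>a = length \<nu>\<close>: \<open>Upper i k\<close> is the \<open>k\<close>-th copy (from the top) of the edge \<open>(1, i + 2)\<close>,
  \<open>Axis i\<close> is the edge \<open>(i, i + 1)\<close>, and \<open>Lower i\<close> is the edge \<open>(i, a + 3)\<close>.
\<close>

datatype caracol_edge = Upper nat nat | Axis nat | Lower nat

definition caracol_edges :: "nat list \<Rightarrow> caracol_edge set" where
  "caracol_edges \<nu> =
    {Upper i k | i k. i \<in> {1..length \<nu>} \<and> k \<in> {1..\<nu> ! (i - 1)}} \<union>
    Axis ` {1..length \<nu> + 2} \<union>
    Lower ` {2..length \<nu> + 1}"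

fun caracol_tail :: "caracol_edge \<Rightarrow> nat" where
  "caracol_tail (Upper i k) = 1"
| "caracol_tail (Axis i) = i"
| "caracol_tail (Lower i) = i"

fun caracol_head :: "nat list \<Rightarrow> caracol_edge \<Rightarrow> nat" where
  "caracol_head \<nu> (Upper i k) = i + 2"
| "caracol_head \<nu> (Axis i) = i + 1"
| "caracol_head \<nu> (Lower i) = length \<nu> + 3"

fun planar_in_less :: "nat \<Rightarrow> caracol_edge \<Rightarrow> caracol_edge \<Rightarrow> bool" where
  "planar_in_less v (Upper i k) (Upper j l) \<longleftrightarrow> i + 2 = v \<and> j + 2 = v \<and> k < l"
| "planar_in_less v (Upper i k) (Axis j) \<longleftrightarrow> i + 2 = v \<and> j + 1 = v"
| "planar_in_less v _ _ \<longleftrightarrow> False"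

fun planar_out_less :: "nat \<Rightarrow> caracol_edge \<Rightarrow> caracol_edge \<Rightarrow> bool" where
  "planar_out_less v (Axis i) (Lower j) \<longleftrightarrow> i = v \<and> j = v"
| "planar_out_less v _ _ \<longleftrightarrow> False"

text \<open>
  The planar-framed caracol graph, with its edges named by a finite type \<^typ>\<open>'e\<close> via \<open>\<epsilon>\<close>; this is
  used only for bijections \<open>\<epsilon>\<close> onto \<^term>\<open>caracol_edges \<nu>\<close>, so that \<^typ>\<open>real^'e\<close> is the space of
  real edge labellings.
\<close>

definition planar_caracol :: "nat list \<Rightarrow> ('e \<Rightarrow> caracol_edge) \<Rightarrow> 'e framed_graph" where
  "planar_caracol \<nu> \<epsilon> =
    \<lparr> sink = length \<nu> + 3,
      tail = (\<lambda>e. caracol_tail (\<epsilon> e)),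
      head = (\<lambda>e. caracol_head \<nu> (\<epsilon> e)),
      in_less = (\<lambda>v e f. planar_in_less v (\<epsilon> e) (\<epsilon> f)),
      out_less = (\<lambda>v e f. planar_out_less v (\<epsilon> e) (\<epsilon> f)) \<rparr>"

end

theory Submission
  imports Defs
begin

text \<open>
  A route is determined by the edge on which it leaves vertex \<open>1\<close> and the edge on which it leaves the axis
  for the sink. Numbering the former \<open>0, \<dots>, b\<close> from bottom to top and the latter \<open>0, \<dots>, a\<close> from right
  to left identifies routes with the grid points \<open>(p, r)\<close> of a region bounded by the partition
  \<open>\<Lambda> = path_partition \<nu>\<close>. Two routes are incoherent if and only if one of their points is strictly
  larger than the other in both coordinates (\<open>coherent_iff\<close>). So the maximal cliques are the monotone
  staircases through the region from \<open>(0, a)\<close> to \<open>(b, 0)\<close>. A staircase is given by the columns \<open>q k\<close> in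
  which it passes from row \<open>k + 1\<close> to row \<open>k\<close>, and these form an arbitrary partition \<open>q \<le> \<Lambda>\<close>
  (\<open>maximal_noncrossing_iff\<close>).

  A flow is determined by its values on these two families of edges (\<open>conserved_eqI\<close>), which are two
  marginals with equal totals. Along a given staircase there is exactly one way to spread the marginals,
  and the masses are differences of their partial sums (\<open>mass\<close>). Thus every flow has a unique expansion in the routes of a given maximal clique, with
  integral coefficients if the flow is integral (\<open>staircase_expansion\<close>, \<open>mass_Ints\<close>): the cells are
  unimodular simplices of full dimension. For a flow in the polytope the staircase can be
  chosen by quantiles of the marginals so that the masses are nonnegative
  (\<open>mass_nonneg_staircase\<close>), hence the cells cover. That this staircase stays below \<open>\<Lambda>\<close> is the
  nonnegativity of the flow on the axis (\<open>exit_flow_dominated\<close>).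

  The height \<open>p * r\<close> makes the triangulation regular. Young's inequality for the step function \<open>q\<close>
  provides a linear function that lies below the heights and touches them precisely on the staircase
  of \<open>q\<close> (\<open>young_inequality\<close>). A family of simplices that cover a polytope and have such strict supports is a
  regular triangulation (\<open>supported_cells_regular\<close>), and this includes that the cells meet face to face
  (\<open>supported_cells_triangulation\<close>).

  Finally, two cells share a facet if and only if their staircases differ in a single point, that is,
  if one corner is flipped, and flipping a corner adds or removes one box of the partition
  (\<open>staircases_adjacent_iff\<close>).
\<close>

section \<open>Simplices, facets and graph isomorphisms\<close>

lemma convex_hull_eq_imp_eq:
  fixes A B :: "'a::euclidean_space set"
  assumes "\<not> affine_dependent A" and "\<not> affine_dependent B" and "convex hull A = convex hull B"
  shows "A = B"
proof (rule set_eqI)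
  fix x
  have "x \<in> A \<longleftrightarrow> x extreme_point_of (convex hull A)"
    by (rule extreme_point_of_convex_hull_affine_independent[OF assms(1), symmetric])
  also have "\<dots> \<longleftrightarrow> x \<in> B"
    unfolding assms(3) by (rule extreme_point_of_convex_hull_affine_independent[OF assms(2)])
  finally show "x \<in> A \<longleftrightarrow> x \<in> B" .
qed

text \<open>
  The facets of a simplex are the hulls of its vertex sets with one vertex left out, and such a hull
  determines the vertices that span it.
\<close>

lemma shared_facet_iff:
  fixes A B :: "'a::euclidean_space set"
  assumes A: "\<not> affine_dependent A" "2 \<le> card A" and B: "\<not> affine_dependent B" "2 \<le> card B"
  shows "(\<exists>F. F facet_of convex hull A \<and> F facet_of convex hull B) \<longleftrightarrow>
    (\<exists>u\<in>A. \<exists>v\<in>B. A - {u} = B - {v})"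
proof -
  have "A - {u} = B - {v}" if "convex hull (A - {u}) = convex hull (B - {v})" for u v
    by (rule convex_hull_eq_imp_eq[OF affine_independent_Diff[OF A(1)] affine_independent_Diff[OF B(1)] that])
  then show ?thesis
    unfolding facet_of_convex_hull_affine_independent_alt[OF A(1)]
      facet_of_convex_hull_affine_independent_alt[OF B(1)]
    using A(2) B(2) by (metis (no_types))
qed

lemma linear_functional_eq_inner:
  fixes f :: "'a::euclidean_space \<Rightarrow> real"
  assumes "linear f"
  obtains c where "\<And>z. c \<bullet> z = f z"
proof
  fix z show "adjoint f 1 \<bullet> z = f z"
    using adjoint_works[OF assms, of z 1] by (simp add: inner_commute)
qed

lemma ugraph_iso_of_inverse:
  assumes g: "bij_betw g (fst H) (fst G)" and edges: "(`) g ` snd H = snd G"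
    and sub: "\<And>e. e \<in> snd H \<Longrightarrow> e \<subseteq> fst H"
  shows "ugraph_iso G H"
  unfolding ugraph_iso_def
proof (intro exI conjI)
  let ?f = "inv_into (fst H) g"
  show "bij_betw ?f (fst G) (fst H)" using g by (rule bij_betw_inv_into)
  have inv: "?f ` g ` e = e" if "e \<in> snd H" for e
    using sub[OF that] g by (auto simp: bij_betw_def image_image inv_into_f_f subset_iff)
  have "(`) ?f ` snd G = (\<lambda>e. ?f ` g ` e) ` snd H" unfolding edges[symmetric] by (simp add: image_image)
  also have "\<dots> = snd H" using inv by simp
  finally show "(`) ?f ` snd G = snd H" .
qed

section \<open>Regular triangulations from strict lower supports\<close>

text \<open>
  The function \<open>v \<mapsto> c \<bullet> v - d\<close> supports the heights \<open>h\<close> from below and touches them precisely on \<open>Z\<close>.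
  Contact sets are the sets of points whose lifts span the lower faces of the lifted point
  configuration.
\<close>

definition contact_set ::
  "'a::euclidean_space set \<Rightarrow> ('a \<Rightarrow> real) \<Rightarrow> 'a \<Rightarrow> real \<Rightarrow> 'a set \<Rightarrow> bool" where
  "contact_set V h c d Z \<longleftrightarrow> (\<forall>v\<in>V. c \<bullet> v - d \<le> h v) \<and> Z = {v \<in> V. c \<bullet> v - d = h v}"

definition lift :: "('a \<Rightarrow> real) \<Rightarrow> 'a set \<Rightarrow> ('a \<times> real) set" where
  "lift h V = (\<lambda>v. (v, h v)) ` V"

text \<open>
  A face of a polytope is spanned by the generators that it contains; the generators on the graph of
  the supporting function are the lifts of the contact points.
\<close>

lemma lift_hull_face:
  fixes V :: "'a::euclidean_space set"
  assumes "finite V" and Z: "contact_set V h c d Z"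
  shows "\<forall>(x, t) \<in> convex hull lift h V. c \<bullet> x - d \<le> t"
    and "{(x, t) \<in> convex hull lift h V. t = c \<bullet> x - d} = convex hull lift h Z"
proof -
  let ?Q = "convex hull lift h V" and ?n = "(-c, 1::real)"
  have "?Q \<subseteq> {y. ?n \<bullet> y \<ge> -d}"
    using Z by (intro hull_minimal) (auto simp: lift_def contact_set_def convex_halfspace_ge algebra_simps)
  then have ge: "\<And>y. y \<in> ?Q \<Longrightarrow> ?n \<bullet> y \<ge> -d" by blast
  then show "\<forall>(x, t) \<in> ?Q. c \<bullet> x - d \<le> t" by fastforce
  have F: "{(x, t) \<in> ?Q. t = c \<bullet> x - d} = ?Q \<inter> {y. ?n \<bullet> y = -d}" by auto
  have face: "(?Q \<inter> {y. ?n \<bullet> y = -d}) face_of ?Q"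
    by (rule face_of_Int_supporting_hyperplane_ge) (use ge in auto)
  have "compact (lift h V)"
    using \<open>finite V\<close> by (simp add: lift_def finite_imp_compact)
  then obtain S where S: "S \<subseteq> lift h V" "?Q \<inter> {y. ?n \<bullet> y = -d} = convex hull S"
    using face_of_convex_hull_subset[OF _ face] by blast
  have "S \<subseteq> ?Q \<inter> {y. ?n \<bullet> y = -d}" using S(2) hull_subset by metis
  have "S \<subseteq> lift h Z"
  proof
    fix y assume "y \<in> S"
    then obtain v where v: "v \<in> V" "y = (v, h v)" using S(1) by (auto simp: lift_def)
    moreover from \<open>y \<in> S\<close> \<open>S \<subseteq> ?Q \<inter> {y. ?n \<bullet> y = -d}\<close> have "?n \<bullet> y = -d" by blast
    ultimately have "v \<in> Z" using Z by (simp add: contact_set_def algebra_simps)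
    with v show "y \<in> lift h Z" by (simp add: lift_def)
  qed
  moreover have "lift h Z \<subseteq> ?Q \<inter> {y. ?n \<bullet> y = -d}"
  proof
    fix y assume "y \<in> lift h Z"
    then obtain v where "v \<in> Z" "y = (v, h v)" by (auto simp: lift_def)
    moreover from this Z have "v \<in> V" "c \<bullet> v - d = h v" by (auto simp: contact_set_def)
    moreover from \<open>v \<in> V\<close> have "(v, h v) \<in> ?Q" by (intro hull_inc) (simp add: lift_def)
    ultimately show "y \<in> ?Q \<inter> {y. ?n \<bullet> y = -d}" by (simp add: algebra_simps)
  qed
  then have "convex hull lift h Z \<subseteq> ?Q \<inter> {y. ?n \<bullet> y = -d}"
    by (rule hull_minimal) (rule face_of_imp_convex[OF face])
  ultimately show "{(x, t) \<in> ?Q. t = c \<bullet> x - d} = convex hull lift h Z"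
    unfolding F using S(2) hull_mono[of S "lift h Z" convex] by (metis subset_antisym)
qed

lemma lower_face_iff_contact_set:
  fixes V :: "'a::euclidean_space set"
  assumes "finite V"
  shows "lower_face (convex hull lift h V) F \<longleftrightarrow>
    (\<exists>c d Z. contact_set V h c d Z \<and> F = convex hull lift h Z)"
proof
  assume "lower_face (convex hull lift h V) F"
  then obtain c d where cd: "\<forall>(x, t)\<in>convex hull lift h V. c \<bullet> x - d \<le> t"
      "F = {(x, t) \<in> convex hull lift h V. t = c \<bullet> x - d}"
    unfolding lower_face_def by blast
  have "contact_set V h c d {v \<in> V. c \<bullet> v - d = h v}"
  proof -
    have "(v, h v) \<in> convex hull lift h V" if "v \<in> V" for v
      using that by (intro hull_inc) (simp add: lift_def)
    with cd(1) show ?thesis unfolding contact_set_def by blast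
  qed
  with lift_hull_face(2)[OF assms this] cd(2) show "\<exists>c d Z. contact_set V h c d Z \<and> F = convex hull lift h Z"
    by (intro exI conjI) auto
next
  assume "\<exists>c d Z. contact_set V h c d Z \<and> F = convex hull lift h Z"
  then obtain c d Z where Z: "contact_set V h c d Z" "F = convex hull lift h Z" by blast
  show "lower_face (convex hull lift h V) F"
    unfolding lower_face_def Z(2)
    by (intro exI[of _ c] exI[of _ d] conjI lift_hull_face(1)[OF assms Z(1)]
        lift_hull_face(2)[OF assms Z(1), symmetric])
qed

lemma mem_lift_hull_contact_set:
  fixes V :: "'a::euclidean_space set"
  assumes "finite V" and "contact_set V h c d Z"
  shows "(x, t) \<in> convex hull lift h Z \<longleftrightarrow> (x, t) \<in> convex hull lift h V \<and> t = c \<bullet> x - d"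
  unfolding lift_hull_face(2)[OF assms, symmetric] by simp

lemma fst_hull_lift: "fst ` (convex hull lift h Z) = convex hull Z"
proof -
  have "fst ` (convex hull lift h Z) = convex hull (fst ` lift h Z)"
    by (rule convex_hull_linear_image) (rule linear_fst)
  then show ?thesis by (simp add: lift_def image_image)
qed

text \<open>
  A face of the simplex on \<open>C\<close> is exposed. Adding a small multiple of the function that exposes it to
  the support of \<open>C\<close> keeps the contacts on the face and loses the other ones.
\<close>

lemma contact_set_face:
  fixes V :: "'a::euclidean_space set"
  assumes "finite V" and C: "contact_set V h c d C" and "\<not> affine_dependent C" and "\<sigma> \<subseteq> C"
  obtains c' d' where "contact_set V h c' d' \<sigma>"
proof -
  have "finite C" using \<open>finite V\<close> C by (auto simp: contact_set_def)
  have "(convex hull \<sigma>) face_of (convex hull C)"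
    using assms face_of_convex_hull_affine_independent by blast
  then have "(convex hull \<sigma>) exposed_face_of (convex hull C)"
    using \<open>finite C\<close> by (simp add: exposed_face_of_polyhedron polyhedron_convex_hull)
  then obtain a b where ab: "convex hull C \<subseteq> {x. a \<bullet> x \<le> b}"
      "convex hull \<sigma> = convex hull C \<inter> {x. a \<bullet> x = b}"
    unfolding exposed_face_of_def by blast
  have le: "a \<bullet> v \<le> b" if "v \<in> C" for v using ab(1) hull_inc[OF that, of convex] by blast
  have eq: "a \<bullet> v = b \<longleftrightarrow> v \<in> \<sigma>" if "v \<in> C" for v
  proof -
    have "v \<in> convex hull \<sigma> \<longleftrightarrow> v \<in> \<sigma>"
    proof
      assume "v \<in> convex hull \<sigma>"
      then have "v \<in> affine hull \<sigma>" using convex_hull_subset_affine_hull by blast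
      show "v \<in> \<sigma>"
      proof (rule ccontr)
        assume "v \<notin> \<sigma>"
        then have "\<sigma> \<subseteq> C - {v}" using \<open>\<sigma> \<subseteq> C\<close> by blast
        then have "v \<in> affine hull (C - {v})" using \<open>v \<in> affine hull \<sigma>\<close> hull_mono by blast
        with \<open>v \<in> C\<close> \<open>\<not> affine_dependent C\<close> show False by (auto simp: affine_dependent_def)
      qed
    qed (rule hull_inc)
    with ab(2) that hull_inc[of v C convex] show ?thesis by blast
  qed
  \<comment> \<open>The finitely many points outside \<open>C\<close> have a positive gap, so a slight tilt creates no new contacts.\<close>
  have "\<exists>e>0. \<forall>v\<in>V - C. e * (a \<bullet> v - b) < h v - (c \<bullet> v - d)"
  proof -
    define f where "f v = (h v - (c \<bullet> v - d)) / (\<bar>a \<bullet> v - b\<bar> + 1)" for v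
    define e where "e = Min (insert 1 (f ` (V - C)))"
    have fin: "finite (insert 1 (f ` (V - C)))" using \<open>finite V\<close> by simp
    have pos: "0 < f v" "0 < h v - (c \<bullet> v - d)" if "v \<in> V - C" for v
    proof -
      from that C have "c \<bullet> v - d \<le> h v" "c \<bullet> v - d \<noteq> h v"
        unfolding contact_set_def by blast+
      then show "0 < h v - (c \<bullet> v - d)" by simp
      then show "0 < f v" unfolding f_def by (intro divide_pos_pos) auto
    qed
    have e: "0 < e" using pos fin by (auto simp: e_def)
    have "e * (a \<bullet> v - b) < h v - (c \<bullet> v - d)" if v: "v \<in> V - C" for v
    proof -
      have "e \<le> f v" using v fin by (auto simp: e_def)
      then have "e * (\<bar>a \<bullet> v - b\<bar> + 1) \<le> h v - (c \<bullet> v - d)"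
        by (simp add: f_def pos_le_divide_eq)
      moreover have "e * (a \<bullet> v - b) < e * (\<bar>a \<bullet> v - b\<bar> + 1)"
        using e by (intro mult_strict_left_mono) auto
      ultimately show ?thesis by linarith
    qed
    with e show ?thesis by blast
  qed
  then obtain e where e: "0 < e" "\<And>v. v \<in> V - C \<Longrightarrow> e * (a \<bullet> v - b) < h v - (c \<bullet> v - d)" by blast
  have val: "(c + e *\<^sub>R a) \<bullet> v - (d + e * b) = (c \<bullet> v - d) + e * (a \<bullet> v - b)" for v
    by (simp add: inner_add_left algebra_simps)
  have on: "c \<bullet> v - d = h v" if "v \<in> C" for v using that C by (auto simp: contact_set_def)
  have inC: "e * (a \<bullet> v - b) \<le> 0" "e * (a \<bullet> v - b) = 0 \<longleftrightarrow> v \<in> \<sigma>" if "v \<in> C" for v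
    using le[OF that] eq[OF that] e(1) by (auto simp: mult_le_0_iff)
  have "contact_set V h (c + e *\<^sub>R a) (d + e * b) \<sigma>"
    unfolding contact_set_def val
  proof (intro conjI ballI set_eqI iffI)
    fix v assume "v \<in> V"
    show "c \<bullet> v - d + e * (a \<bullet> v - b) \<le> h v"
      using inC(1)[of v] on[of v] e(2)[of v] \<open>v \<in> V\<close> by (cases "v \<in> C") force+
  next
    fix v assume "v \<in> \<sigma>"
    then show "v \<in> {v \<in> V. c \<bullet> v - d + e * (a \<bullet> v - b) = h v}"
      using on[of v] inC(2)[of v] \<open>\<sigma> \<subseteq> C\<close> C by (auto simp: contact_set_def)
  next
    fix v assume "v \<in> {v \<in> V. c \<bullet> v - d + e * (a \<bullet> v - b) = h v}"
    then show "v \<in> \<sigma>"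
      using on[of v] inC(2)[of v] e(2)[of v] by (cases "v \<in> C") force+
  qed
  then show thesis by (rule that)
qed

text \<open>
  Over a point of the hull of a contact set, the supporting function has the height of the lower
  boundary of the lifted polytope, which does not depend on the support.
\<close>

lemma contact_values_agree:
  fixes V :: "'a::euclidean_space set"
  assumes "finite V" and "contact_set V h c d Z" and "contact_set V h c' d' Z'"
    and "x \<in> convex hull Z" and "x \<in> convex hull Z'"
  shows "c \<bullet> x - d = c' \<bullet> x - d'"
proof -
  obtain t where "(x, t) \<in> convex hull lift h Z"
    using assms(4) fst_hull_lift[of h Z] by force
  then have t: "(x, t) \<in> convex hull lift h V" "t = c \<bullet> x - d"
    unfolding mem_lift_hull_contact_set[OF assms(1,2)] by blast+
  obtain t' where "(x, t') \<in> convex hull lift h Z'"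
    using assms(5) fst_hull_lift[of h Z'] by force
  then have t': "(x, t') \<in> convex hull lift h V" "t' = c' \<bullet> x - d'"
    unfolding mem_lift_hull_contact_set[OF assms(1,3)] by blast+
  have "c' \<bullet> x - d' \<le> t" using lift_hull_face(1)[OF assms(1,3)] t(1) by blast
  moreover have "c \<bullet> x - d \<le> t'" using lift_hull_face(1)[OF assms(1,2)] t'(1) by blast
  ultimately show ?thesis using t(2) t'(2) by linarith
qed

lemma hull_Int_contact_sets:
  fixes V :: "'a::euclidean_space set"
  assumes "finite V" and Z: "contact_set V h c d Z" and Z': "contact_set V h c' d' Z'"
  shows "convex hull Z \<inter> convex hull Z' = convex hull (Z \<inter> Z')"
proof
  show "convex hull (Z \<inter> Z') \<subseteq> convex hull Z \<inter> convex hull Z'"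
    by (simp add: hull_mono)
  show "convex hull Z \<inter> convex hull Z' \<subseteq> convex hull (Z \<inter> Z')"
  proof
    fix x assume x: "x \<in> convex hull Z \<inter> convex hull Z'"
    \<comment> \<open>The mean of the two supporting functions touches exactly where both do.\<close>
    let ?c = "(1/2) *\<^sub>R (c + c')" and ?d = "(d + d') / 2"
    have val: "?c \<bullet> v - ?d = ((c \<bullet> v - d) + (c' \<bullet> v - d')) / 2" for v
      by (simp add: inner_add_left field_simps)
    have "contact_set V h ?c ?d (Z \<inter> Z')"
      unfolding contact_set_def val
    proof (intro conjI ballI set_eqI iffI)
      fix v assume v: "v \<in> V"
      then have "c \<bullet> v - d \<le> h v" "c' \<bullet> v - d' \<le> h v" using Z Z' by (auto simp: contact_set_def)
      then show "((c \<bullet> v - d) + (c' \<bullet> v - d')) / 2 \<le> h v" by (simp add: field_simps)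
    next
      fix v assume "v \<in> Z \<inter> Z'"
      then show "v \<in> {v \<in> V. ((c \<bullet> v - d) + (c' \<bullet> v - d')) / 2 = h v}"
        using Z Z' by (auto simp: contact_set_def)
    next
      fix v assume v: "v \<in> {v \<in> V. ((c \<bullet> v - d) + (c' \<bullet> v - d')) / 2 = h v}"
      then have "c \<bullet> v - d \<le> h v" "c' \<bullet> v - d' \<le> h v" using Z Z' by (auto simp: contact_set_def)
      with v have "c \<bullet> v - d = h v" "c' \<bullet> v - d' = h v" by auto
      with v show "v \<in> Z \<inter> Z'" using Z Z' by (auto simp: contact_set_def)
    qed
    note mid = mem_lift_hull_contact_set[OF \<open>finite V\<close> this]
    obtain t where t: "(x, t) \<in> convex hull lift h Z"
      using x fst_hull_lift[of h Z] by force
    then have "(x, t) \<in> convex hull lift h V" "t = c \<bullet> x - d"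
      unfolding mem_lift_hull_contact_set[OF assms(1,2)] by blast+
    moreover have "c \<bullet> x - d = c' \<bullet> x - d'"
      using contact_values_agree[OF assms] x by blast
    then have "?c \<bullet> x - ?d = c \<bullet> x - d" unfolding val by simp
    ultimately have "(x, t) \<in> convex hull lift h (Z \<inter> Z')"
      using mid by simp
    then have "fst (x, t) \<in> fst ` (convex hull lift h (Z \<inter> Z'))" by (rule imageI)
    then show "x \<in> convex hull (Z \<inter> Z')" by (simp add: fst_hull_lift)
  qed
qed

text \<open>
  The barycentre of \<open>Z\<close> lies in some cell. There the supports of \<open>Z\<close> and of the cell have the same value,
  so the gaps between the heights and the support of the cell, which are nonnegative, have mean \<open>0\<close>
  over \<open>Z\<close>. Hence \<open>Z\<close> consists of contact points of the cell.
\<close>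

lemma contact_set_within_cell:
  fixes V :: "'a::euclidean_space set"
  assumes "finite V" and Z: "contact_set V h c d Z" and "Z \<noteq> {}"
    and cells: "\<And>C. C \<in> \<M> \<Longrightarrow> \<exists>c d. contact_set V h c d C"
    and cover: "convex hull V \<subseteq> (\<Union>C\<in>\<M>. convex hull C)"
  obtains C where "C \<in> \<M>" "Z \<subseteq> C"
proof -
  have ZV: "Z \<subseteq> V" and "finite Z" using Z \<open>finite V\<close> by (auto simp: contact_set_def)
  define n where "n = real (card Z)"
  define x where "x = (\<Sum>z\<in>Z. (1/n) *\<^sub>R z)"
  have n: "n > 0" using \<open>finite Z\<close> \<open>Z \<noteq> {}\<close> by (simp add: n_def card_gt_0_iff)
  have xZ: "x \<in> convex hull Z"
    unfolding x_def
  proof (rule convex_sum[OF \<open>finite Z\<close> convex_convex_hull])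
    show "(\<Sum>i\<in>Z. 1/n) = 1" using n by (simp add: n_def)
  qed (use n hull_inc in auto)
  then have "x \<in> convex hull V" using ZV hull_mono by blast
  with cover obtain C where C: "C \<in> \<M>" "x \<in> convex hull C" by blast
  obtain c' d' where C': "contact_set V h c' d' C" using cells C(1) by blast
  have ag: "c \<bullet> x - d = c' \<bullet> x - d'"
    using contact_values_agree[OF \<open>finite V\<close> Z C' xZ C(2)] .
  have mean: "k \<bullet> x - l = (\<Sum>z\<in>Z. k \<bullet> z - l) / n" for k l
    using n by (simp add: x_def inner_sum_right sum_subtractf n_def divide_simps sum_divide_distrib[symmetric])
  have sum0: "(\<Sum>z\<in>Z. h z - (c' \<bullet> z - d')) = 0"
  proof -
    have "(\<Sum>z\<in>Z. h z - (c' \<bullet> z - d')) = (\<Sum>z\<in>Z. (c \<bullet> z - d) - (c' \<bullet> z - d'))"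
      using Z by (intro sum.cong) (auto simp: contact_set_def)
    also have "\<dots> = (\<Sum>z\<in>Z. c \<bullet> z - d) - (\<Sum>z\<in>Z. c' \<bullet> z - d')" by (rule sum_subtractf)
    also have "\<dots> = 0" using ag n unfolding mean by (simp add: field_simps)
    finally show ?thesis .
  qed
  have "h z - (c' \<bullet> z - d') = 0" if "z \<in> Z" for z
    using sum_nonneg_eq_0_iff[OF \<open>finite Z\<close>, of "\<lambda>z. h z - (c' \<bullet> z - d')"] sum0 that ZV C'
    by (force simp: contact_set_def)
  then have "Z \<subseteq> C" using ZV C' by (auto simp: contact_set_def)
  with C(1) show thesis by (rule that)
qed

text \<open>
  If each of a family of simplices has its own support that touches the heights precisely at the vertices
  of the simplex, then covering the hull is all that is needed of the family to be a regular
  triangulation: faces inherit strict supports, strict supports force the cells to meet along common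
  faces, and every lower face lies over a face of some cell because the cells cover the barycentre of
  its contact points.
\<close>

lemma
  fixes V :: "'a::euclidean_space set" and h :: "'a \<Rightarrow> real" and \<M> :: "'a set set"
  assumes "finite V" and union: "\<Union>\<M> = V" and ne: "\<M> \<noteq> {}"
    and indep: "\<And>C. C \<in> \<M> \<Longrightarrow> \<not> affine_dependent C"
    and supp: "\<And>C. C \<in> \<M> \<Longrightarrow> \<exists>c d. contact_set V h c d C"
    and cover: "convex hull V \<subseteq> (\<Union>C\<in>\<M>. convex hull C)"
  defines "T \<equiv> {F. \<exists>C\<in>\<M>. F face_of convex hull C}"
  shows supported_cells_triangulation: "triangulation_of T (convex hull V)"
    and supported_cells_regular: "regular_triangulation T"
proof -
  have T: "T = {convex hull \<sigma> | \<sigma>. \<exists>C\<in>\<M>. \<sigma> \<subseteq> C}"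
    using indep unfolding T_def by (auto simp: face_of_convex_hull_affine_independent)
  have face_supp: "\<exists>c d. contact_set V h c d \<sigma>" if "C \<in> \<M>" "\<sigma> \<subseteq> C" for C \<sigma>
  proof -
    obtain c d where "contact_set V h c d C" using supp \<open>C \<in> \<M>\<close> by blast
    from contact_set_face[OF \<open>finite V\<close> this indep[OF \<open>C \<in> \<M>\<close>] \<open>\<sigma> \<subseteq> C\<close>] show ?thesis by blast
  qed
  have indep': "\<not> affine_dependent \<sigma>" if "C \<in> \<M>" "\<sigma> \<subseteq> C" for C \<sigma>
    using indep that affine_dependent_subset by blast
  have "simplicial_complex T"
    unfolding simplicial_complex_def
  proof (intro conjI ballI allI impI)
    have "T \<subseteq> (\<lambda>\<sigma>. convex hull \<sigma>) ` Pow V" using union by (auto simp: T)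
    then show "finite T" by (rule finite_subset) (simp add: \<open>finite V\<close>)
  next
    fix S assume "S \<in> T"
    then obtain \<sigma> C where "C \<in> \<M>" "\<sigma> \<subseteq> C" "S = convex hull \<sigma>" by (auto simp: T)
    then have "int (card \<sigma>) - 1 simplex S"
      unfolding simplex_def using indep' by (intro exI[of _ \<sigma>]) simp
    then show "\<exists>n. n simplex S" by blast
  next
    fix F S assume "S \<in> T \<and> F face_of S"
    then show "F \<in> T" unfolding T_def using face_of_trans by blast
  next
    fix S S' assume "S \<in> T \<and> S' \<in> T"
    then obtain \<sigma> C \<sigma>' C' where C: "C \<in> \<M>" "\<sigma> \<subseteq> C" "S = convex hull \<sigma>"
      and C': "C' \<in> \<M>" "\<sigma>' \<subseteq> C'" "S' = convex hull \<sigma>'" by (auto simp: T)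
    have "S \<inter> S' = convex hull (\<sigma> \<inter> \<sigma>')"
      using face_supp[OF C(1,2)] face_supp[OF C'(1,2)] hull_Int_contact_sets[OF \<open>finite V\<close>] C(3) C'(3)
      by blast
    then show "(S \<inter> S') face_of S"
      unfolding C(3) using face_of_convex_hull_affine_independent[OF indep'[OF C(1,2)]] by blast
  qed
  moreover have "\<Union>T = convex hull V"
  proof
    show "\<Union>T \<subseteq> convex hull V"
    proof
      fix x assume "x \<in> \<Union>T"
      then obtain C where "C \<in> \<M>" "x \<in> convex hull C"
        unfolding T_def using face_of_imp_subset by blast
      then show "x \<in> convex hull V" using union hull_mono[of C V convex] by blast
    qed
    have "convex hull C \<in> T" if "C \<in> \<M>" for C using that by (auto simp: T)
    then show "convex hull V \<subseteq> \<Union>T" using cover by blast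
  qed
  ultimately show "triangulation_of T (convex hull V)" by (simp add: triangulation_of_def)

  have vertices: "{v} \<in> T \<longleftrightarrow> v \<in> V" for v
  proof
    assume "{v} \<in> T"
    then obtain \<sigma> C where C: "C \<in> \<M>" "\<sigma> \<subseteq> C" "{v} = convex hull \<sigma>" by (auto simp: T)
    then have "\<sigma> \<noteq> {}" "\<sigma> \<subseteq> {v}" using hull_subset[of \<sigma> convex] by auto
    then have "v \<in> C" using C(2) by blast
    with C(1) union show "v \<in> V" by blast
  next
    assume "v \<in> V"
    then obtain C where "C \<in> \<M>" "{v} \<subseteq> C" using union by blast
    moreover have "{v} = convex hull {v}" by simp
    ultimately show "{v} \<in> T" unfolding T by blast
  qed
  have lift: "{(v, h v) | v. {v} \<in> T} = lift h V" by (auto simp: lift_def vertices)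
  have "T = {fst ` F | F. lower_face (convex hull {(v, h v) | v. {v} \<in> T}) F}"
    unfolding lift lower_face_iff_contact_set[OF \<open>finite V\<close>]
  proof (intro set_eqI iffI)
    fix S assume "S \<in> T"
    then obtain \<sigma> C where C: "C \<in> \<M>" "\<sigma> \<subseteq> C" "S = convex hull \<sigma>" by (auto simp: T)
    then have "S = fst ` (convex hull lift h \<sigma>)" by (simp add: fst_hull_lift)
    with face_supp[OF C(1,2)] show "S \<in> {fst ` F | F. \<exists>c d Z. contact_set V h c d Z \<and> F = convex hull lift h Z}"
      by blast
  next
    fix S assume "S \<in> {fst ` F | F. \<exists>c d Z. contact_set V h c d Z \<and> F = convex hull lift h Z}"
    then obtain c d Z where Z: "contact_set V h c d Z" "S = convex hull Z"
      by (auto simp: fst_hull_lift)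
    show "S \<in> T"
    proof (cases "Z = {}")
      case True
      obtain C where "C \<in> \<M>" "{} \<subseteq> C" using ne by blast
      then show ?thesis using Z(2) True unfolding T by blast
    next
      case False
      with contact_set_within_cell[OF \<open>finite V\<close> Z(1) _ supp cover] obtain C where "C \<in> \<M>" "Z \<subseteq> C" by blast
      then show ?thesis using Z(2) by (auto simp: T)
    qed
  qed
  then show "regular_triangulation T" unfolding regular_triangulation_def by (rule exI[of _ h])
qed

section \<open>Principal ideals of Young's lattice\<close>

lemma young_cover_le: "young_cover p q \<Longrightarrow> p \<le> q"
  by (auto simp: young_cover_def le_fun_def)

lemma young_cover_irrefl: "\<not> young_cover q q"
proof
  assume "young_cover q q"
  then obtain k where "q (Suc k) < q k" "q = q(k := q k - 1)" by (auto simp: young_cover_def)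
  then have "q k = q k - 1" by (metis fun_upd_same)
  then show False using \<open>q (Suc k) < q k\<close> by simp
qed

lemma remove_corner_partition:
  assumes "q \<in> partitions" and "q (Suc k) < q k"
  shows "q(k := q k - 1) \<in> partitions"
proof -
  have anti: "antimono q" and fin: "finite {i. q i \<noteq> 0}" using assms(1) by (auto simp: partitions_def)
  have "antimono (q(k := q k - 1))"
  proof (rule antimonoI)
    fix i j :: nat assume "i \<le> j"
    have "q j \<le> q i" using antimonoD[OF anti \<open>i \<le> j\<close>] .
    moreover have "q j \<le> q k - 1" if "i = k" "j \<noteq> k"
    proof -
      have "Suc k \<le> j" using that \<open>i \<le> j\<close> by simp
      then have "q j \<le> q (Suc k)" by (rule antimonoD[OF anti])
      then show ?thesis using assms(2) by linarith
    qed
    ultimately show "(q(k := q k - 1)) j \<le> (q(k := q k - 1)) i" by (auto simp: le_diff_conv)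
  qed
  moreover have "{i. (q(k := q k - 1)) i \<noteq> 0} \<subseteq> {i. q i \<noteq> 0}" by auto
  then have "finite {i. (q(k := q k - 1)) i \<noteq> 0}" using fin finite_subset by blast
  ultimately show ?thesis by (simp add: partitions_def)
qed

text \<open>
  In the last row in which \<open>p\<close> is shorter than \<open>q\<close>, the next row of \<open>q\<close> agrees with that of \<open>p\<close> and is
  therefore shorter than this row: the row ends in a corner, which can be removed without leaving the
  partitions above \<open>p\<close>.
\<close>

lemma young_cover_between:
  assumes p: "p \<in> partitions" and q: "q \<in> partitions" and "p \<le> q" and "p \<noteq> q"
  obtains k where "p \<le> q(k := q k - 1)" "young_cover (q(k := q k - 1)) q" "p k < q k"
proof -
  define D where "D = {k. p k \<noteq> q k}"
  have "D \<subseteq> {k. q k \<noteq> 0}" 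
  proof
    fix i assume "i \<in> D"
    then have "p i \<noteq> q i" "p i \<le> q i" using \<open>p \<le> q\<close> by (auto simp: D_def le_fun_def)
    then show "i \<in> {k. q k \<noteq> 0}" by auto
  qed
  then have "finite D" using q by (auto simp: partitions_def intro: finite_subset)
  moreover have "D \<noteq> {}" using \<open>p \<noteq> q\<close> by (auto simp: D_def)
  ultimately have "Max D \<in> D" and max: "\<And>k. k \<in> D \<Longrightarrow> k \<le> Max D" by auto
  define k where "k = Max D"
  have lt: "p k < q k" using \<open>Max D \<in> D\<close> \<open>p \<le> q\<close> by (auto simp: D_def k_def le_fun_def order_less_le)
  have "Suc k \<notin> D" using max[of "Suc k"] by (auto simp: k_def)
  then have "q (Suc k) = p (Suc k)" by (simp add: D_def)
  also have "\<dots> \<le> p k" using p by (intro antimonoD[of p]) (auto simp: partitions_def)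
  finally have "q (Suc k) < q k" using lt by simp
  then have "young_cover (q(k := q k - 1)) q" using q by (auto simp: young_cover_def)
  moreover have "p \<le> q(k := q k - 1)" using \<open>p \<le> q\<close> lt by (auto simp: le_fun_def)
  ultimately show thesis using lt that by blast
qed

text \<open>
  For the reverse direction corners of \<open>q\<close> are removed until \<open>p\<close> is reached; the number of boxes drops
  at each step.
\<close>

lemma young_le_iff:
  assumes "p \<in> partitions" and "q \<in> partitions"
  shows "young_le p q \<longleftrightarrow> p \<le> q"
proof
  assume "young_le p q"
  then show "p \<le> q"
    unfolding young_le_def by (induction rule: rtranclp_induct) (auto dest: young_cover_le)
next
  assume "p \<le> q"
  have fin: "finite {i. q i \<noteq> 0}" using assms(2) by (simp add: partitions_def)
  with assms(2) \<open>p \<le> q\<close> show "young_le p q"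
  proof (induction "\<Sum>i | q i \<noteq> 0. q i" arbitrary: q rule: less_induct)
    case less
    show ?case
    proof (cases "p = q")
      case True
      then show ?thesis by (simp add: young_le_def)
    next
      case False
      then obtain k where k: "p \<le> q(k := q k - 1)" "young_cover (q(k := q k - 1)) q" "p k < q k"
        using young_cover_between[OF assms(1) less.prems(1,2)] by blast
      let ?r = "q(k := q k - 1)"
      have sub: "{i. ?r i \<noteq> 0} \<subseteq> {i. q i \<noteq> 0}" by auto
      have r: "?r \<in> partitions"
        using remove_corner_partition[OF less.prems(1)] k(2,3)
        by (auto simp: young_cover_def fun_eq_iff split: if_splits)
      have "(\<Sum>i | ?r i \<noteq> 0. ?r i) = (\<Sum>i | q i \<noteq> 0. ?r i)"
        using sub less.prems(3) by (intro sum.mono_neutral_left) auto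
      also have "\<dots> < (\<Sum>i | q i \<noteq> 0. q i)"
        using less.prems(3) k(3) by (intro sum_strict_mono_ex1) auto
      finally have "young_le p ?r"
        using less.hyps[of ?r] r k(1) finite_subset[OF sub less.prems(3)] by blast
      then show ?thesis using k(2) unfolding young_le_def by simp
    qed
  qed
qed

lemma young_ideal_eq:
  assumes "q \<in> partitions"
  shows "young_ideal q = {p \<in> partitions. p \<le> q}"
  using young_le_iff[OF _ assms] by (auto simp: young_ideal_def)

section \<open>Staircases\<close>

text \<open>
  The rows of the grid are numbered \<open>0, \<dots>, a\<close> from the top and its columns \<open>0, \<dots>, b\<close> from the left. A
  staircase climbs from \<open>(0, a)\<close> to \<open>(b, 0)\<close>, passing from row \<open>k + 1\<close> to row \<open>k\<close> in column \<open>q k\<close>; thus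
  \<open>shelf b q r\<close> is the column in which it leaves row \<open>r\<close>.
\<close>

definition shelf :: "nat \<Rightarrow> (nat \<Rightarrow> nat) \<Rightarrow> nat \<Rightarrow> nat" where
  "shelf b q r = (case r of 0 \<Rightarrow> b | Suc k \<Rightarrow> q k)"

definition region :: "nat \<Rightarrow> nat \<Rightarrow> (nat \<Rightarrow> nat) \<Rightarrow> (nat \<times> nat) set" where
  "region a b q = {(p, r). r \<le> a \<and> p \<le> shelf b q r}"

definition staircase :: "nat \<Rightarrow> nat \<Rightarrow> (nat \<Rightarrow> nat) \<Rightarrow> (nat \<times> nat) set" where
  "staircase a b q = {(p, r). r \<le> a \<and> q r \<le> p \<and> p \<le> shelf b q r}"

text \<open>
  Points that cross stand for incoherent routes. The rows are counted from the top, so a set of points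
  without crossings climbs to the right.
\<close>

definition crossing :: "nat \<times> nat \<Rightarrow> nat \<times> nat \<Rightarrow> bool" where
  "crossing c c' \<longleftrightarrow> fst c < fst c' \<and> snd c < snd c'"

definition noncrossing :: "(nat \<times> nat) set \<Rightarrow> bool" where
  "noncrossing C \<longleftrightarrow> (\<forall>c\<in>C. \<forall>c'\<in>C. \<not> crossing c c')"

definition box_bounded :: "nat \<Rightarrow> nat \<Rightarrow> (nat \<Rightarrow> nat) \<Rightarrow> bool" where
  "box_bounded a b q \<longleftrightarrow> antimono q \<and> (\<forall>k. q k \<le> b) \<and> (\<forall>k\<ge>a. q k = 0)"

lemma box_bounded_antimono: "box_bounded a b q \<Longrightarrow> i \<le> j \<Longrightarrow> q j \<le> q i"
  by (rule antimonoD) (simp_all add: box_bounded_def)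

lemma box_bounded_le: "box_bounded a b q \<Longrightarrow> q k \<le> b"
  by (simp add: box_bounded_def)

lemma box_bounded_zero: "box_bounded a b q \<Longrightarrow> a \<le> k \<Longrightarrow> q k = 0"
  by (simp add: box_bounded_def)

lemma box_bounded_pos: "box_bounded a b q \<Longrightarrow> 0 < q k \<Longrightarrow> k < a"
  using box_bounded_zero[of a b q k] by (cases "a \<le> k") auto

lemma box_bounded_mono:
  assumes "box_bounded a b \<Lambda>" and "q \<in> partitions" and "q \<le> \<Lambda>"
  shows "box_bounded a b q"
proof -
  have le: "q k \<le> \<Lambda> k" for k using \<open>q \<le> \<Lambda>\<close> by (rule le_funD)
  have "q k \<le> b" for k using le[of k] box_bounded_le[OF assms(1), of k] by linarith
  moreover have "q k = 0" if "a \<le> k" for k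
    using le[of k] box_bounded_zero[OF assms(1) that] by linarith
  ultimately show ?thesis using assms(2) by (auto simp: box_bounded_def partitions_def)
qed

lemma box_bounded_partition: "box_bounded a b q \<Longrightarrow> q \<in> partitions"
proof -
  assume q: "box_bounded a b q"
  then have "{k. q k \<noteq> 0} \<subseteq> {..<a}" using box_bounded_pos[OF q] by auto
  then show ?thesis using q finite_subset by (auto simp: box_bounded_def partitions_def)
qed

lemma shelf_0 [simp]: "shelf b q 0 = b" and shelf_Suc [simp]: "shelf b q (Suc k) = q k"
  by (simp_all add: shelf_def)

lemma shelf_le: "box_bounded a b q \<Longrightarrow> shelf b q r \<le> b"
  by (cases r) (auto simp: box_bounded_le)

lemma le_shelf: "box_bounded a b q \<Longrightarrow> q r \<le> shelf b q r"
  by (cases r) (auto simp: box_bounded_le intro: box_bounded_antimono)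

lemma shelf_le_below:
  assumes "box_bounded a b q" and "r < s"
  shows "shelf b q s \<le> q r"
  using assms by (cases s) (auto intro: box_bounded_antimono)

lemma staircase_noncrossing:
  assumes "box_bounded a b q"
  shows "noncrossing (staircase a b q)"
proof -
  have False if "r < r'" "p < p'" "q r \<le> p" "p' \<le> shelf b q r'" for p p' r r'
    using shelf_le_below[OF assms that(1)] that by linarith
  then show ?thesis by (auto simp: noncrossing_def crossing_def staircase_def)
qed

lemma staircase_subset_region:
  assumes "q \<le> \<Lambda>" 
  shows "staircase a b q \<subseteq> region a b \<Lambda>"
proof -
  have "shelf b q r \<le> shelf b \<Lambda> r" for r using assms by (cases r) (auto simp: le_fun_def)
  then have "p \<le> shelf b \<Lambda> r" if "p \<le> shelf b q r" for p r using that le_trans by blast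
  then show ?thesis by (auto simp: staircase_def region_def)
qed

text \<open>
  The staircase changes from row \<open>k + 1\<close> to row \<open>k\<close> as far to the left as \<open>C\<close> permits, namely in the last
  column that \<open>C\<close> occupies below row \<open>k\<close>. The points of \<open>C\<close> in row \<open>k\<close> and above are not to the left of this
  column because nothing crosses.
\<close>

lemma noncrossing_subset_staircase:
  assumes \<Lambda>: "box_bounded a b \<Lambda>" and "C \<subseteq> region a b \<Lambda>" and "noncrossing C"
  obtains q where "q \<in> partitions" "q \<le> \<Lambda>" "C \<subseteq> staircase a b q"
proof -
  define A where "A k = insert 0 {p. \<exists>r. (p, r) \<in> C \<and> k < r}" for k
  define q where "q k = Max (A k)" for k
  have bound: "p \<le> \<Lambda> k" if "(p, r) \<in> C" "k < r" for p r k
  proof -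
    have "p \<le> shelf b \<Lambda> r" using that(1) \<open>C \<subseteq> region a b \<Lambda>\<close> by (auto simp: region_def)
    then show ?thesis using shelf_le_below[OF \<Lambda> that(2)] by simp
  qed
  have A: "finite (A k)" "A k \<noteq> {}" for k
  proof -
    have "A k \<subseteq> {..\<Lambda> k}" using bound by (auto simp: A_def)
    then show "finite (A k)" using finite_subset by blast
  qed (simp add: A_def)
  have le: "q k \<le> \<Lambda> k" for k using A bound by (auto simp: q_def A_def)
  have ge: "p \<le> q k" if "(p, r) \<in> C" "k < r" for p r k
    unfolding q_def using A that by (intro Max_ge) (auto simp: A_def)
  have "antimono q"
  proof (rule antimonoI)
    fix i j :: nat assume "i \<le> j"
    then have "A j \<subseteq> A i" by (auto simp: A_def)
    then show "q j \<le> q i" unfolding q_def using A by (intro Max_mono)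
  qed
  moreover have "{k. q k \<noteq> 0} \<subseteq> {..<a}"
  proof
    fix k assume "k \<in> {k. q k \<noteq> 0}"
    then have "0 < \<Lambda> k" using le[of k] by simp
    then show "k \<in> {..<a}" using box_bounded_pos[OF \<Lambda>] by simp
  qed
  then have "finite {k. q k \<noteq> 0}" using finite_subset by blast
  ultimately have "q \<in> partitions" by (simp add: partitions_def)
  moreover have "C \<subseteq> staircase a b q"
  proof
    fix c assume "c \<in> C"
    obtain p r where c: "c = (p, r)" by (cases c)
    have reg: "r \<le> a" "p \<le> shelf b \<Lambda> r" using \<open>c \<in> C\<close> \<open>C \<subseteq> region a b \<Lambda>\<close> c by (auto simp: region_def)
    have "p \<le> shelf b q r"
      using reg ge[of p r "r - 1"] \<open>c \<in> C\<close> c by (cases r) auto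
    moreover have "x \<le> p" if "x \<in> A r" for x
      using that \<open>c \<in> C\<close> c \<open>noncrossing C\<close> by (force simp: A_def noncrossing_def crossing_def)
    then have "q r \<le> p" using A by (simp add: q_def)
    ultimately show "c \<in> staircase a b q" using reg c by (simp add: staircase_def)
  qed
  ultimately show thesis using le that by (auto simp: le_fun_def)
qed

lemma staircase_corners:
  assumes "box_bounded a b q"
  shows "k \<le> a \<Longrightarrow> (q k, k) \<in> staircase a b q" and "k < a \<Longrightarrow> (q k, Suc k) \<in> staircase a b q"
  using le_shelf[OF assms] box_bounded_antimono[OF assms, of k "Suc k"]
  by (auto simp: staircase_def)

text \<open>
  In column \<open>q k\<close> a staircase has points in the rows \<open>k\<close> and \<open>k + 1\<close>, and no other column has both.
\<close>

lemma staircase_subset_imp_eq: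
  assumes q: "box_bounded a b q" and q': "box_bounded a b q'" and sub: "staircase a b q \<subseteq> staircase a b q'"
  shows "q = q'"
proof
  fix k
  show "q k = q' k"
  proof (cases "k < a")
    case True
    then have "(q k, k) \<in> staircase a b q'" "(q k, Suc k) \<in> staircase a b q'"
      using staircase_corners[OF q] sub by auto
    then show ?thesis by (simp add: staircase_def)
  next
    case False
    then show ?thesis using q q' by (simp add: box_bounded_def)
  qed
qed

text \<open>
  Every set without crossings extends to a staircase, and distinct staircases are incomparable.
\<close>

lemma maximal_noncrossing_iff:
  assumes \<Lambda>: "box_bounded a b \<Lambda>"
  shows "(C \<subseteq> region a b \<Lambda> \<and> noncrossing C \<and>
      (\<forall>D. D \<subseteq> region a b \<Lambda> \<and> noncrossing D \<and> C \<subseteq> D \<longrightarrow> D = C)) \<longleftrightarrow>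
    (\<exists>q\<in>partitions. q \<le> \<Lambda> \<and> C = staircase a b q)" (is "?max C \<longleftrightarrow> _")
proof
  assume C: "?max C"
  then have "C \<subseteq> region a b \<Lambda>" "noncrossing C" by simp_all
  then obtain q where q: "q \<in> partitions" "q \<le> \<Lambda>" "C \<subseteq> staircase a b q"
    by (rule noncrossing_subset_staircase[OF \<Lambda>])
  have "noncrossing (staircase a b q)"
    using staircase_noncrossing[OF box_bounded_mono[OF \<Lambda> q(1,2)]] .
  then have "staircase a b q = C" using C q(3) staircase_subset_region[OF q(2)] by simp
  with q show "\<exists>q\<in>partitions. q \<le> \<Lambda> \<and> C = staircase a b q" by blast
next
  assume "\<exists>q\<in>partitions. q \<le> \<Lambda> \<and> C = staircase a b q"
  then obtain q where q: "q \<in> partitions" "q \<le> \<Lambda>" "C = staircase a b q" by blast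
  note bq = box_bounded_mono[OF \<Lambda> q(1,2)]
  show "?max C"
  proof (intro conjI allI impI)
    show "C \<subseteq> region a b \<Lambda>" using staircase_subset_region[OF q(2)] q(3) by simp
    show "noncrossing C" using staircase_noncrossing[OF bq] q(3) by simp
    fix D assume D: "D \<subseteq> region a b \<Lambda> \<and> noncrossing D \<and> C \<subseteq> D"
    then have "D \<subseteq> region a b \<Lambda>" "noncrossing D" by simp_all
    then obtain q' where q': "q' \<in> partitions" "q' \<le> \<Lambda>" "D \<subseteq> staircase a b q'"
      by (rule noncrossing_subset_staircase[OF \<Lambda>])
    with D have "staircase a b q \<subseteq> staircase a b q'" using q(3) by blast
    then have "q = q'" using staircase_subset_imp_eq[OF bq box_bounded_mono[OF \<Lambda> q'(1,2)]] by blast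
    then show "D = C" using q(3) q'(3) D by blast
  qed
qed

lemma finite_staircase: "finite (staircase a b q)"
proof -
  have "staircase a b q \<subseteq> (\<Union>r\<in>{..a}. {..shelf b q r} \<times> {r})" by (auto simp: staircase_def)
  then show ?thesis by (rule finite_subset) auto
qed

text \<open>
  Removing the last box of row \<open>k\<close> flips one corner of the staircase.
\<close>

lemma staircase_remove_box:
  assumes q: "box_bounded a b q" and "q (Suc k) < q k"
  shows "staircase a b q - {(q k, Suc k)} = staircase a b (q(k := q k - 1)) - {(q k - 1, k)}"
    and "(q k, Suc k) \<in> staircase a b q" and "(q k - 1, k) \<in> staircase a b (q(k := q k - 1))"
proof -
  have k: "k < a" using box_bounded_pos[OF q, of k] \<open>q (Suc k) < q k\<close> by simp
  show "(q k, Suc k) \<in> staircase a b q" using staircase_corners[OF q] k by blast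
  have "q k \<le> shelf b q k" using le_shelf[OF q] .
  moreover have "shelf b (q(k := q k - 1)) k = shelf b q k" by (cases k) auto
  ultimately show "(q k - 1, k) \<in> staircase a b (q(k := q k - 1))"
    using k by (auto simp: staircase_def)
  show "staircase a b q - {(q k, Suc k)} = staircase a b (q(k := q k - 1)) - {(q k - 1, k)}"
  proof (intro set_eqI)
    fix c :: "nat \<times> nat"
    obtain p r where c: "c = (p, r)" by (cases c)
    consider "r = k" | "r = Suc k" | "r \<noteq> k" "r \<noteq> Suc k" by blast
    then show "c \<in> staircase a b q - {(q k, Suc k)} \<longleftrightarrow>
      c \<in> staircase a b (q(k := q k - 1)) - {(q k - 1, k)}"
    proof cases
      case 1
      have "shelf b (q(k := q k - 1)) k = shelf b q k" by (cases k) auto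
      then show ?thesis using 1 c assms(2) by (auto simp: staircase_def)
    next
      case 2
      then show ?thesis using c assms(2) by (auto simp: staircase_def)
    next
      case 3
      then have "shelf b (q(k := q k - 1)) r = shelf b q r" by (cases r) auto
      then show ?thesis using 3 c by (auto simp: staircase_def)
    qed
  qed
qed

text \<open>
  A row \<open>k\<close> with \<open>q k < q' k\<close> puts \<open>(q k, k)\<close> into the first staircase only and \<open>(q' k, k + 1)\<close> into the
  second only, so these are the exchanged points \<open>c\<close> and \<open>c'\<close>. They leave room neither for another row in
  which \<open>q\<close> and \<open>q'\<close> differ nor for a difference of more than one box.
\<close>

lemma staircases_differ_in_one_point:
  assumes q: "box_bounded a b q" and q': "box_bounded a b q'"
    and eq: "staircase a b q - {c} = staircase a b q' - {c'}"
    and lt: "q k < q' k"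
  shows "young_cover q q'"
proof -
  have k: "k < a" using box_bounded_pos[OF q', of k] lt by simp
  have c: "c = (q i, i)" and c': "c' = (q' i, Suc i)" if "i < a" "q i < q' i" for i
  proof -
    have "(q i, i) \<in> staircase a b q" "(q i, i) \<notin> staircase a b q'"
      using staircase_corners[OF q] that by (auto simp: staircase_def)
    then show "c = (q i, i)" using eq by blast
    have "(q' i, Suc i) \<in> staircase a b q'" "(q' i, Suc i) \<notin> staircase a b q"
      using staircase_corners[OF q'] that by (auto simp: staircase_def)
    then show "c' = (q' i, Suc i)" using eq by blast
  qed
  have d: "c' = (q' i, i)" "c = (q i, Suc i)" if "i < a" "q' i < q i" for i
  proof -
    have "(q' i, i) \<in> staircase a b q'" "(q' i, i) \<notin> staircase a b q"
      using staircase_corners[OF q'] that by (auto simp: staircase_def)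
    then show "c' = (q' i, i)" using eq by blast
    have "(q i, Suc i) \<in> staircase a b q" "(q i, Suc i) \<notin> staircase a b q'"
      using staircase_corners[OF q] that by (auto simp: staircase_def)
    then show "c = (q i, Suc i)" using eq by blast
  qed
  have other: "q i = q' i" if "i \<noteq> k" for i
  proof (cases "i < a")
    case True
    show ?thesis
    proof (rule ccontr)
      assume "q i \<noteq> q' i"
      then consider "q i < q' i" | "q' i < q i" by linarith
      then show False
        using c[OF True] c[OF k lt] d[OF True] c'[OF k lt] that by cases auto
    qed
  next
    case False
    then show ?thesis using q q' by (simp add: box_bounded_def)
  qed
  have qk: "q (Suc k) \<le> q k" by (rule box_bounded_antimono[OF q]) simp
  have "q' k = Suc (q k)"
  proof (rule ccontr)
    assume "q' k \<noteq> Suc (q k)"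
    with lt have big: "Suc (q k) < q' k" by simp
    then have "(q' k - 1, Suc k) \<in> staircase a b q'" "(q' k - 1, Suc k) \<notin> staircase a b q"
      using k qk other[of "Suc k"] by (auto simp: staircase_def)
    then have "c' = (q' k - 1, Suc k)" using eq by blast
    with c'[OF k lt] big show False by simp
  qed
  then have "q = q'(k := q' k - 1)" using other by (auto simp: fun_eq_iff)
  moreover have "q' (Suc k) < q' k" using lt qk other[of "Suc k"] by simp
  ultimately show ?thesis
    using box_bounded_partition[OF q'] by (auto simp: young_cover_def)
qed

lemma staircases_adjacent_iff:
  assumes q: "box_bounded a b q" and q': "box_bounded a b q'" and "q \<noteq> q'"
  shows "(\<exists>c\<in>staircase a b q. \<exists>c'\<in>staircase a b q'. staircase a b q - {c} = staircase a b q' - {c'}) \<longleftrightarrow>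
    young_cover q q' \<or> young_cover q' q"
proof
  assume "\<exists>c\<in>staircase a b q. \<exists>c'\<in>staircase a b q'. staircase a b q - {c} = staircase a b q' - {c'}"
  then obtain c c' where eq: "staircase a b q - {c} = staircase a b q' - {c'}" by blast
  obtain k where "q k < q' k \<or> q' k < q k" using \<open>q \<noteq> q'\<close> by (metis ext linorder_neqE_nat)
  then show "young_cover q q' \<or> young_cover q' q"
    using staircases_differ_in_one_point[OF q q' eq] staircases_differ_in_one_point[OF q' q eq[symmetric]]
    by blast
next
  have cover: "\<exists>c\<in>staircase a b q. \<exists>c'\<in>staircase a b q'. staircase a b q - {c} = staircase a b q' - {c'}"
    if "box_bounded a b q" "young_cover q' q" for q q'
    using that staircase_remove_box[OF that(1)] unfolding young_cover_def by blast
  assume "young_cover q q' \<or> young_cover q' q"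
  then show "\<exists>c\<in>staircase a b q. \<exists>c'\<in>staircase a b q'. staircase a b q - {c} = staircase a b q' - {c'}"
    using cover[OF q] cover[OF q'] by (metis (no_types, lifting))
qed

section \<open>Young's inequality on staircases\<close>

text \<open>
  Both sides are compared termwise by \<open>p + (q k - p) = q k + (p - q k)\<close>, which holds for truncated
  subtraction because both sides are the maximum of \<open>p\<close> and \<open>q k\<close>.
\<close>

lemma young_inequality_defect:
  fixes q :: "nat \<Rightarrow> nat"
  assumes "r \<le> a"
  shows "p * r + (\<Sum>k<a. q k - p) =
    (\<Sum>k<r. q k) + ((\<Sum>k<r. p - q k) + (\<Sum>k\<in>{r..<a}. q k - p))"
proof -
  have "{..<a} = {..<r} \<union> {r..<a}" using assms by auto
  then have "(\<Sum>k<a. q k - p) = (\<Sum>k<r. q k - p) + (\<Sum>k\<in>{r..<a}. q k - p)"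
    by (simp add: sum.union_disjoint ivl_disj_int)
  moreover have "p * r + (\<Sum>k<r. q k - p) = (\<Sum>k<r. p + (q k - p))"
    by (simp add: sum.distrib mult.commute)
  moreover have "\<dots> = (\<Sum>k<r. q k + (p - q k))" by (intro sum.cong) auto
  ultimately show ?thesis by (simp add: sum.distrib mult.commute)
qed

text \<open>
  Young's inequality for the step function \<open>q\<close>: the first \<open>r\<close> rows of the Young diagram of \<open>q\<close> are covered
  by a rectangle with \<open>r\<close> rows and \<open>p\<close> columns together with the part of the diagram to the right of
  column \<open>p\<close>. Nothing is wasted if and only if the corner of the rectangle is on the boundary of the diagram, which
  is the staircase.
\<close>

lemma young_inequality:
  fixes q :: "nat \<Rightarrow> nat"
  assumes q: "box_bounded a b q" and "r \<le> a" and "p \<le> b"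
  shows "(\<Sum>k<r. q k) \<le> p * r + (\<Sum>k<a. q k - p)"
    and "(\<Sum>k<r. q k) = p * r + (\<Sum>k<a. q k - p) \<longleftrightarrow> (p, r) \<in> staircase a b q"
proof -
  note defect = young_inequality_defect[OF \<open>r \<le> a\<close>, of p q]
  show "(\<Sum>k<r. q k) \<le> p * r + (\<Sum>k<a. q k - p)" unfolding defect by simp
  have "(\<Sum>k<r. q k) = p * r + (\<Sum>k<a. q k - p) \<longleftrightarrow>
      (\<forall>k<r. p \<le> q k) \<and> (\<forall>k\<in>{r..<a}. q k \<le> p)"
    unfolding defect by auto
  also have "(\<forall>k<r. p \<le> q k) \<longleftrightarrow> p \<le> shelf b q r"
  proof
    assume "\<forall>k<r. p \<le> q k"
    then show "p \<le> shelf b q r" using \<open>p \<le> b\<close> by (cases r) auto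
  next
    assume "p \<le> shelf b q r"
    then show "\<forall>k<r. p \<le> q k" using shelf_le_below[OF q] le_trans by blast
  qed
  also have "(\<forall>k\<in>{r..<a}. q k \<le> p) \<longleftrightarrow> q r \<le> p"
  proof
    assume "\<forall>k\<in>{r..<a}. q k \<le> p"
    then show "q r \<le> p" using box_bounded_zero[OF q, of r] by (cases "r < a") auto
  next
    assume "q r \<le> p"
    then show "\<forall>k\<in>{r..<a}. q k \<le> p"
      using box_bounded_antimono[OF q, of r] le_trans by (metis atLeastLessThan_iff)
  qed
  finally show "(\<Sum>k<r. q k) = p * r + (\<Sum>k<a. q k - p) \<longleftrightarrow> (p, r) \<in> staircase a b q"
    using \<open>r \<le> a\<close> by (auto simp: staircase_def)
qed

section \<open>Distributing marginals along a staircase\<close>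

text \<open>
  Marginals \<open>x\<close> on the columns and \<open>y\<close> on the rows are to be spread along the staircase of \<open>q\<close>.
  \<open>level a b q x y r p\<close> is the mass on the part of the staircase that precedes column \<open>p\<close> of row \<open>r\<close> on
  the way up. This part consists of all points below row \<open>r\<close>, of all points to the left of column
  \<open>p\<close>, or of all points in row \<open>r\<close> and below, so its mass is a partial sum of one of the marginals.
\<close>

definition level ::
  "nat \<Rightarrow> nat \<Rightarrow> (nat \<Rightarrow> nat) \<Rightarrow> (nat \<Rightarrow> real) \<Rightarrow> (nat \<Rightarrow> real) \<Rightarrow> nat \<Rightarrow> nat \<Rightarrow> real" where
  "level a b q x y r p =
    (if p \<le> q r then \<Sum>s\<in>{r<..a}. y s
     else if p \<le> shelf b q r then \<Sum>i<p. x i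
     else \<Sum>s\<in>{r..a}. y s)"

text \<open>
  In each row the levels telescope, and they are constant off the staircase. The masses depend linearly
  on the marginals and are integral for integral ones. Along the staircase of the quantiles of
  nonnegative marginals they are the masses of the northwest corner rule.
\<close>

definition mass ::
  "nat \<Rightarrow> nat \<Rightarrow> (nat \<Rightarrow> nat) \<Rightarrow> (nat \<Rightarrow> real) \<Rightarrow> (nat \<Rightarrow> real) \<Rightarrow> nat \<times> nat \<Rightarrow> real" where
  "mass a b q x y c = level a b q x y (snd c) (Suc (fst c)) - level a b q x y (snd c) (fst c)"

lemma mass_outside:
  assumes q: "box_bounded a b q" and "r \<le> a" and "(p, r) \<notin> staircase a b q"
  shows "mass a b q x y (p, r) = 0"
proof -
  have "p < q r \<or> shelf b q r < p" using assms by (auto simp: staircase_def)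
  then show ?thesis using le_shelf[OF q, of r] by (auto simp: mass_def level_def)
qed

lemma tail_sum_Suc:
  fixes y :: "nat \<Rightarrow> 'a::comm_monoid_add"
  assumes "r \<le> a"
  shows "(\<Sum>s\<in>{r..a}. y s) = y r + (\<Sum>s\<in>{r<..a}. y s)"
  using assms by (rule sum.head)

lemma mass_row_sum:
  assumes q: "box_bounded a b q" and "r \<le> a"
  shows "(\<Sum>p\<le>b. mass a b q x y (p, r)) = y r"
proof -
  have "(\<Sum>p\<le>b. mass a b q x y (p, r)) = level a b q x y r (Suc b) - level a b q x y r 0"
    unfolding mass_def fst_conv snd_conv lessThan_Suc_atMost[symmetric] by (rule sum_lessThan_telescope)
  also have "\<dots> = (\<Sum>s\<in>{r..a}. y s) - (\<Sum>s\<in>{r<..a}. y s)"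
    using shelf_le[OF q, of r] box_bounded_le[OF q, of r] by (simp add: level_def)
  also have "\<dots> = y r" using tail_sum_Suc[OF \<open>r \<le> a\<close>, of y] by simp
  finally show ?thesis .
qed

text \<open>
  For \<open>0 < p \<le> b\<close> a single row contributes the partial sum of \<open>x\<close>. The rows above and below it contribute
  tails of \<open>y\<close>, which together are the tails beyond each \<open>r < a\<close>, once each, whatever \<open>p\<close> is. The column
  sums of the masses are differences of these sums.
\<close>

lemma level_column_sum:
  assumes q: "box_bounded a b q" and total: "(\<Sum>i\<le>b. x i) = (\<Sum>s\<le>a. y s)" and "p \<le> Suc b"
  shows "(\<Sum>r\<le>a. level a b q x y r p) = (\<Sum>i<p. x i) + (\<Sum>r<a. \<Sum>s\<in>{r<..a}. y s)"
proof -
  let ?Y = "\<lambda>r. \<Sum>s\<in>{r<..a}. y s"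
  have shift: "(\<Sum>s\<in>{Suc r..a}. y s) = ?Y r" for r by (simp add: atLeastSucAtMost_greaterThanAtMost)
  consider "p = 0" | "p = Suc b" | "0 < p" "p \<le> b" using \<open>p \<le> Suc b\<close> by linarith
  then show ?thesis
  proof cases
    case 1
    then have "(\<Sum>r\<le>a. level a b q x y r p) = (\<Sum>r\<le>a. ?Y r)" by (simp add: level_def)
    also have "\<dots> = (\<Sum>r<a. ?Y r) + ?Y a" by (simp add: lessThan_Suc_atMost[symmetric])
    finally show ?thesis using 1 by simp
  next
    case 2
    then have "\<not> p \<le> shelf b q r" "\<not> p \<le> q r" for r
      using shelf_le[OF q, of r] box_bounded_le[OF q, of r] by linarith+
    then have "(\<Sum>r\<le>a. level a b q x y r p) = (\<Sum>r\<le>a. \<Sum>s\<in>{r..a}. y s)"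
      by (simp add: level_def)
    also have "\<dots> = (\<Sum>s\<in>{0..a}. y s) + (\<Sum>r<a. \<Sum>s\<in>{Suc r..a}. y s)"
      unfolding lessThan_Suc_atMost[symmetric] by (rule sum.lessThan_Suc_shift)
    also have "\<dots> = (\<Sum>i<p. x i) + (\<Sum>r<a. ?Y r)"
      using total 2 by (simp add: shift atLeast0AtMost lessThan_Suc_atMost)
    finally show ?thesis .
  next
    case 3
    \<comment> \<open>Exactly one row has \<open>p\<close> in its half-open range \<open>(q r, shelf b q r]\<close>.\<close>
    define m where "m = (LEAST r. q r < p)"
    have "q a < p" using box_bounded_zero[OF q, of a] 3 by simp
    then have m: "q m < p" "m \<le> a" unfolding m_def by (auto intro: LeastI Least_le)
    have before: "p \<le> q r" if "r < m" for r using not_less_Least[of r "\<lambda>r. q r < p"] that by (simp add: m_def)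
    have at: "p \<le> shelf b q m" using before 3 by (cases m) auto
    have after: "\<not> p \<le> shelf b q r" "\<not> p \<le> q r" if "m < r" for r
      using shelf_le_below[OF q that] m(1) le_shelf[OF q, of r] by linarith+
    have "(\<Sum>r\<le>a. level a b q x y r p) =
      (\<Sum>r<m. level a b q x y r p) + (level a b q x y m p + (\<Sum>r\<in>{m<..a}. level a b q x y r p))"
    proof -
      have "{..a} = {..<m} \<union> {m..a}" using m(2) by auto
      then have "(\<Sum>r\<le>a. level a b q x y r p) =
          (\<Sum>r<m. level a b q x y r p) + (\<Sum>r\<in>{m..a}. level a b q x y r p)"
        by (simp add: sum.union_disjoint ivl_disj_int)
      then show ?thesis by (simp add: tail_sum_Suc[OF m(2)])
    qed
    also have "(\<Sum>r<m. level a b q x y r p) = (\<Sum>r<m. ?Y r)"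
      using before by (intro sum.cong) (auto simp: level_def)
    also have "level a b q x y m p = (\<Sum>i<p. x i)" using m(1) at by (simp add: level_def)
    also have "(\<Sum>r\<in>{m<..a}. level a b q x y r p) = (\<Sum>r\<in>{m<..a}. \<Sum>s\<in>{r..a}. y s)"
      using after by (intro sum.cong) (auto simp: level_def)
    also have "\<dots> = (\<Sum>r\<in>{m..<a}. \<Sum>s\<in>{Suc r..a}. y s)"
      by (rule sum.reindex_bij_witness[of _ Suc "\<lambda>r. r - 1"]) auto
    also have "\<dots> = (\<Sum>r\<in>{m..<a}. ?Y r)" by (simp add: shift)
    also have "(\<Sum>r<m. ?Y r) + ((\<Sum>i<p. x i) + (\<Sum>r\<in>{m..<a}. ?Y r)) = (\<Sum>i<p. x i) + (\<Sum>r<a. ?Y r)"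
    proof -
      have "{..<a} = {..<m} \<union> {m..<a}" using m(2) by auto
      then show ?thesis by (simp add: sum.union_disjoint ivl_disj_int)
    qed
    finally show ?thesis .
  qed
qed

lemma mass_column_sum:
  assumes "box_bounded a b q" and "(\<Sum>i\<le>b. x i) = (\<Sum>s\<le>a. y s)" and "p \<le> b"
  shows "(\<Sum>r\<le>a. mass a b q x y (p, r)) = x p"
  using level_column_sum[OF assms(1,2), of p] level_column_sum[OF assms(1,2), of "Suc p"] assms(3)
  by (simp add: mass_def sum_subtractf)

text \<open>
  The masses on the staircase have the marginals \<open>x\<close> and \<open>y\<close>; this is stated for weighted sums
  because coordinates of flows arise in this form.
\<close>

lemma mass_staircase_sum:
  assumes q: "box_bounded a b q"
  shows "(\<Sum>c\<in>staircase a b q. mass a b q x y c * f (snd c)) = (\<Sum>r\<le>a. y r * f r)"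
    and "(\<Sum>i\<le>b. x i) = (\<Sum>s\<le>a. y s) \<Longrightarrow>
      (\<Sum>c\<in>staircase a b q. mass a b q x y c * f (fst c)) = (\<Sum>p\<le>b. x p * f p)"
proof -
  have sub: "staircase a b q \<subseteq> {..b} \<times> {..a}"
  proof
    fix c assume "c \<in> staircase a b q"
    then show "c \<in> {..b} \<times> {..a}" using shelf_le[OF q, of "snd c"] by (auto simp: staircase_def)
  qed
  have extend: "(\<Sum>c\<in>staircase a b q. mass a b q x y c * g c) = (\<Sum>c\<in>{..b} \<times> {..a}. mass a b q x y c * g c)"
    for g
  proof (rule sum.mono_neutral_left[OF _ sub])
    show "\<forall>c\<in>{..b} \<times> {..a} - staircase a b q. mass a b q x y c * g c = 0"
      using mass_outside[OF q] by auto
  qed simp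
  have "(\<Sum>c\<in>{..b} \<times> {..a}. mass a b q x y c * f (snd c)) =
      (\<Sum>r\<le>a. \<Sum>p\<le>b. mass a b q x y (p, r) * f r)"
    by (subst sum.swap) (simp add: sum.cartesian_product case_prod_unfold)
  also have "\<dots> = (\<Sum>r\<le>a. y r * f r)"
    using mass_row_sum[OF q] by (simp add: sum_distrib_right[symmetric])
  finally show "(\<Sum>c\<in>staircase a b q. mass a b q x y c * f (snd c)) = (\<Sum>r\<le>a. y r * f r)"
    unfolding extend .
  assume total: "(\<Sum>i\<le>b. x i) = (\<Sum>s\<le>a. y s)"
  have "(\<Sum>c\<in>{..b} \<times> {..a}. mass a b q x y c * f (fst c)) =
      (\<Sum>p\<le>b. \<Sum>r\<le>a. mass a b q x y (p, r) * f p)"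
    by (simp add: sum.cartesian_product case_prod_unfold)
  also have "\<dots> = (\<Sum>p\<le>b. x p * f p)"
    using mass_column_sum[OF q total] by (simp add: sum_distrib_right[symmetric])
  finally show "(\<Sum>c\<in>staircase a b q. mass a b q x y c * f (fst c)) = (\<Sum>p\<le>b. x p * f p)"
    unfolding extend .
qed

text \<open>
  The marginals of a point of the staircase are spread back to that point alone. Hence the masses form the
  basis dual to the points of the staircase.
\<close>

lemma mass_point:
  assumes q: "box_bounded a b q" and c: "c \<in> staircase a b q" and d: "d \<in> staircase a b q"
  shows "mass a b q (\<lambda>i. if i = fst d then 1 else 0) (\<lambda>s. if s = snd d then 1 else 0) c =
    (if c = d then 1 else 0)"
proof -
  obtain p r i s where cd: "c = (p, r)" "d = (i, s)" by (cases c, cases d)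
  have below: "shelf b q s \<le> q r" if "r < s" using shelf_le_below[OF q that] .
  have above: "shelf b q r \<le> q s" if "s < r" using shelf_le_below[OF q that] .
  have bounds: "r \<le> a" "s \<le> a" "q r \<le> p" "p \<le> shelf b q r" "q s \<le> i" "i \<le> shelf b q s"
    using c d cd by (auto simp: staircase_def)
  have X: "(\<Sum>k<n. if k = i then 1 else 0 :: real) = (if i < n then 1 else 0)" for n
    by (simp add: sum.delta)
  have Y: "(\<Sum>t\<in>{n<..a}. if t = s then 1 else 0 :: real) = (if n < s then 1 else 0)"
    "(\<Sum>t\<in>{n..a}. if t = s then 1 else 0 :: real) = (if n \<le> s then 1 else 0)" for n
    using bounds by (simp_all add: sum.delta)
  show ?thesis
    unfolding cd mass_def level_def fst_conv snd_conv X Y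
    using bounds below above by (cases r s rule: linorder_cases) auto
qed

lemma linear_mass:
  fixes x y :: "'v::real_vector \<Rightarrow> nat \<Rightarrow> real"
  assumes "\<And>i. linear (\<lambda>z. x z i)" and "\<And>s. linear (\<lambda>z. y z s)"
  shows "linear (\<lambda>z. mass a b q (x z) (y z) c)"
proof -
  have "linear (\<lambda>z. level a b q (x z) (y z) r p)" for r p
    using assms linear_compose_sum[where f = "\<lambda>i z. x z i"] linear_compose_sum[where f = "\<lambda>s z. y z s"]
    unfolding level_def by (cases "p \<le> q r"; cases "p \<le> shelf b q r") simp_all
  then show ?thesis unfolding mass_def by (intro linear_compose_sub)
qed

lemma mass_Ints:
  assumes "\<And>i. x i \<in> \<int>" and "\<And>s. y s \<in> \<int>"
  shows "mass a b q x y c \<in> \<int>"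
proof -
  have "level a b q x y r p \<in> \<int>" for r p using assms by (auto simp: level_def)
  then show ?thesis by (auto simp: mass_def)
qed

text \<open>
  Nonnegative marginals admit a staircase with nonnegative masses: it passes from row \<open>k + 1\<close> to row \<open>k\<close>
  in the first column at which the columns read so far hold the mass of all rows below row \<open>k\<close>. The
  domination hypothesis bounds this quantile by \<open>\<Lambda> k\<close>.
\<close>

lemma mass_nonneg_staircase:
  fixes x y :: "nat \<Rightarrow> real"
  assumes \<Lambda>: "box_bounded a b \<Lambda>"
    and x: "\<And>i. 0 \<le> x i" and y: "\<And>s. 0 \<le> y s" and total: "(\<Sum>i\<le>b. x i) = (\<Sum>s\<le>a. y s)"
    and dom: "\<And>k. k < a \<Longrightarrow> (\<Sum>s\<in>{k<..a}. y s) \<le> (\<Sum>i\<le>\<Lambda> k. x i)"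
  obtains q where "q \<in> partitions" "q \<le> \<Lambda>" "\<And>c. c \<in> staircase a b q \<Longrightarrow> 0 \<le> mass a b q x y c"
proof -
  let ?Y = "\<lambda>k. \<Sum>s\<in>{k<..a}. y s"
  define q where "q k = (LEAST p. ?Y k \<le> (\<Sum>i\<le>p. x i))" for k
  have dom': "?Y k \<le> (\<Sum>i\<le>\<Lambda> k. x i)" for k
    using dom[of k] x by (cases "k < a") (auto simp: sum_nonneg)
  have qge: "?Y k \<le> (\<Sum>i\<le>q k. x i)" for k unfolding q_def using dom' by (rule LeastI)
  have qle: "q k \<le> p" if "?Y k \<le> (\<Sum>i\<le>p. x i)" for k p unfolding q_def using that by (rule Least_le)
  have qlt: "(\<Sum>i<p. x i) \<le> ?Y k" if "p \<le> q k" for k p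
  proof (cases p)
    case 0
    then show ?thesis using y by (simp add: sum_nonneg)
  next
    case (Suc n)
    then have "\<not> ?Y k \<le> (\<Sum>i\<le>n. x i)" using qle[of k n] that by auto
    then show ?thesis using Suc by (simp add: lessThan_Suc_atMost)
  qed
  have le: "q \<le> \<Lambda>" using qle dom' by (auto simp: le_fun_def)
  have "antimono q"
  proof (rule antimonoI)
    fix i j :: nat assume "i \<le> j"
    then have "?Y j \<le> ?Y i" using y by (intro sum_mono2) auto
    then show "q j \<le> q i" using qge[of i] by (intro qle) linarith
  qed
  moreover have "{k. q k \<noteq> 0} \<subseteq> {..<a}"
  proof
    fix k assume "k \<in> {k. q k \<noteq> 0}"
    then have "0 < \<Lambda> k" using le_funD[OF le, of k] by simp
    then show "k \<in> {..<a}" using box_bounded_pos[OF \<Lambda>] by simp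
  qed
  then have "finite {k. q k \<noteq> 0}" using finite_subset by blast
  ultimately have q: "q \<in> partitions" by (simp add: partitions_def)
  have "0 \<le> mass a b q x y c" if "c \<in> staircase a b q" for c
  proof -
    obtain p r where c: "c = (p, r)" by (cases c)
    have pr: "r \<le> a" "q r \<le> p" "p \<le> shelf b q r" using that c by (auto simp: staircase_def)
    have shelf: "(\<Sum>i<p. x i) \<le> (\<Sum>s\<in>{r..a}. y s)"
    proof (cases r)
      case 0
      have "(\<Sum>i<p. x i) \<le> (\<Sum>i\<le>b. x i)" using pr(3) 0 x by (intro sum_mono2) auto
      then show ?thesis using 0 total by (simp add: atLeast0AtMost)
    next
      case (Suc k)
      then show ?thesis using qlt[of p k] pr(3) by (simp add: atLeastSucAtMost_greaterThanAtMost)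
    qed
    have "(\<Sum>i<p. x i) \<le> (\<Sum>i<Suc p. x i)" using x by simp
    moreover have "?Y r \<le> (\<Sum>s\<in>{r..a}. y s)" using tail_sum_Suc[OF pr(1), of y] y by simp
    moreover have "?Y r \<le> (\<Sum>i<Suc p. x i)" if "p \<le> q r"
      using qge[of r] pr(2) that by (simp add: lessThan_Suc_atMost)
    ultimately show ?thesis using pr shelf unfolding c mass_def level_def by auto
  qed
  then show thesis using q le that by blast
qed

section \<open>Routes as unit flows\<close>

lemma dipath_balance:
  "dipath G i R k \<Longrightarrow>
    (\<Sum>e\<leftarrow>R. of_bool (tail G e = j)) + of_bool (k = j) =
    (\<Sum>e\<leftarrow>R. of_bool (head G e = j)) + (of_bool (i = j) :: real)"
proof (induction R arbitrary: i)
  case (Cons e R)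
  then have "tail G e = i" "dipath G (head G e) R k" by simp_all
  then show ?case using Cons.IH[of "head G e"] by simp
qed simp

lemma dipath_increasing:
  assumes "\<And>e. tail G e < head G e"
  shows "dipath G i R k \<Longrightarrow> distinct R \<and> (\<forall>e\<in>set R. i \<le> tail G e)"
proof (induction R arbitrary: i)
  case (Cons e R)
  have "tail G e = i" "dipath G (head G e) R k" using Cons.prems by simp_all
  with Cons.IH[OF this(2)] assms[of e] show ?case by fastforce
qed simp

lemma sum_indicator_vec:
  assumes "distinct R"
  shows "(\<Sum>e | Q e. indicator_vec R $ e) = (\<Sum>e\<leftarrow>R. of_bool (Q e))"
proof -
  have "(\<Sum>e | Q e. indicator_vec R $ e) = (\<Sum>e\<in>set R. of_bool (Q e))"
    unfolding indicator_vec_def by (auto intro!: sum.mono_neutral_cong simp: of_bool_def split: if_splits)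
  then show ?thesis using assms by (simp add: sum_list_distinct_conv_sum_set)
qed

text \<open>
  A path enters and leaves each vertex equally often, up to its two ends, and it repeats no edge because
  its vertices increase.
\<close>

lemma route_in_flow_polytope:
  fixes G :: "('e::finite) framed_graph"
  assumes incr: "\<And>e. tail G e < head G e" and pos: "\<And>e. 1 \<le> tail G e"
    and "1 < sink G" and R: "R \<in> routes G"
  shows "indicator_vec R \<in> flow_polytope G"
proof -
  have dp: "dipath G 1 R (sink G)" using R by (simp add: routes_def)
  then have dist: "distinct R" using dipath_increasing[OF incr] by blast
  note bal = dipath_balance[OF dp]
  have "head G e \<noteq> 1" for e using incr[of e] pos[of e] by simp
  then have "(\<Sum>e\<leftarrow>R. of_bool (tail G e = 1)) = (1::real)" using bal[of 1] \<open>1 < sink G\<close> by simp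
  then have "(\<Sum>e | tail G e = 1. indicator_vec R $ e) = 1" by (simp add: sum_indicator_vec[OF dist])
  moreover have "(\<Sum>e | tail G e = j. indicator_vec R $ e) = (\<Sum>e | head G e = j. indicator_vec R $ e)"
    if "j \<in> inner_vertices G" for j
    using bal[of j] that by (auto simp: sum_indicator_vec[OF dist] inner_vertices_def)
  moreover have "0 \<le> indicator_vec R $ e" for e by (simp add: indicator_vec_def)
  ultimately show ?thesis by (simp add: flow_polytope_def)
qed

section \<open>The partition of a lattice path\<close>

definition partial_sum :: "nat list \<Rightarrow> nat \<Rightarrow> nat" where
  "partial_sum \<nu> i = sum_list (take i \<nu>)"

lemma partial_sum_0 [simp]: "partial_sum \<nu> 0 = 0"
  by (simp add: partial_sum_def)

lemma partial_sum_length [simp]: "partial_sum \<nu> (length \<nu>) = sum_list \<nu>"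
  by (simp add: partial_sum_def)

lemma partial_sum_Suc: "i < length \<nu> \<Longrightarrow> partial_sum \<nu> (Suc i) = partial_sum \<nu> i + \<nu> ! i"
  by (simp add: partial_sum_def take_Suc_conv_app_nth)

lemma partial_sum_eq_sum: "i \<le> length \<nu> \<Longrightarrow> partial_sum \<nu> i = (\<Sum>j<i. \<nu> ! j)"
  by (induction i) (simp_all add: partial_sum_Suc)

lemma partial_sum_mono: "i \<le> j \<Longrightarrow> partial_sum \<nu> i \<le> partial_sum \<nu> j"
proof -
  assume "i \<le> j"
  then have "take j \<nu> = take i \<nu> @ take (j - i) (drop i \<nu>)"
    by (metis le_add_diff_inverse take_add)
  then show ?thesis by (simp add: partial_sum_def)
qed

lemma path_partition_eq:
  assumes "k < length \<nu>"
  shows "path_partition \<nu> k = partial_sum \<nu> (length \<nu> - Suc k)"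
proof -
  let ?a = "length \<nu>"
  have "{..<?a} = {..<?a - Suc k} \<union> {?a - Suc k..<?a}" using assms by auto
  then have "sum_list \<nu> = partial_sum \<nu> (?a - Suc k) + (\<Sum>j\<in>{?a - Suc k..<?a}. \<nu> ! j)"
    using partial_sum_eq_sum[of ?a \<nu>] partial_sum_eq_sum[of "?a - Suc k" \<nu>]
    by (simp add: sum.union_disjoint ivl_disj_int)
  also have "(\<Sum>j\<in>{?a - Suc k..<?a}. \<nu> ! j) = (\<Sum>i = ?a - k..?a. \<nu> ! (i - 1))"
    by (rule sum.reindex_bij_witness[of _ "\<lambda>i. i - 1" Suc]) (use assms in auto)
  finally show ?thesis using assms by (simp add: path_partition_def)
qed

lemma path_partition_box_bounded: "box_bounded (length \<nu>) (sum_list \<nu>) (path_partition \<nu>)"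
  unfolding box_bounded_def
proof (intro conjI allI impI antimonoI)
  fix i j :: nat assume "i \<le> j"
  show "path_partition \<nu> j \<le> path_partition \<nu> i"
  proof (cases "j < length \<nu>")
    case True
    then show ?thesis using \<open>i \<le> j\<close> by (simp add: path_partition_eq partial_sum_mono)
  next
    case False
    then show ?thesis by (simp add: path_partition_def)
  qed
next
  fix k show "path_partition \<nu> k \<le> sum_list \<nu>" by (simp add: path_partition_def)
next
  fix k assume "length \<nu> \<le> k"
  then show "path_partition \<nu> k = 0" by (simp add: path_partition_def)
qed

lemma upt_split: "i \<le> j \<Longrightarrow> j \<le> k \<Longrightarrow> [i..<k] = [i..<j] @ [j..<k]"
  by (metis le_Suc_ex upt_add_eq_append)

section \<open>The caracol graph and its grid coordinates\<close>

locale caracol =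
  fixes \<nu> :: "nat list" and \<epsilon> :: "'e::finite \<Rightarrow> caracol_edge"
  assumes nonempty: "\<nu> \<noteq> []"
    and bij: "bij_betw \<epsilon> UNIV (caracol_edges \<nu>)"
begin

abbreviation "a \<equiv> length \<nu>"
abbreviation "b \<equiv> sum_list \<nu>"

text \<open>
  \<open>m i\<close> counts the edges from vertex \<open>1\<close> that enter the axis at one of the vertices \<open>3, \<dots>, i + 2\<close>.
\<close>

abbreviation "m \<equiv> partial_sum \<nu>"
abbreviation "\<Lambda> \<equiv> path_partition \<nu>"
abbreviation "G \<equiv> planar_caracol \<nu> \<epsilon>"

definition edge :: "caracol_edge \<Rightarrow> 'e" where
  "edge = inv \<epsilon>"

lemma edge_\<epsilon> [simp]: "edge (\<epsilon> e) = e"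
  using bij by (simp add: edge_def bij_betw_def)

lemma \<epsilon>_edge [simp]: "x \<in> caracol_edges \<nu> \<Longrightarrow> \<epsilon> (edge x) = x"
  using bij by (simp add: edge_def bij_betw_def f_inv_into_f)

lemma \<epsilon>_in [simp]: "\<epsilon> e \<in> caracol_edges \<nu>"
  using bij by (auto simp: bij_betw_def)

lemma inj_edge: "inj_on edge (caracol_edges \<nu>)"
  by (metis \<epsilon>_edge inj_onI)

lemma a_pos: "0 < a"
  using nonempty by simp

lemma graph_simps [simp]:
  "sink G = a + 3" "tail G e = caracol_tail (\<epsilon> e)" "head G e = caracol_head \<nu> (\<epsilon> e)"
  "in_less G v e f = planar_in_less v (\<epsilon> e) (\<epsilon> f)" "out_less G v e f = planar_out_less v (\<epsilon> e) (\<epsilon> f)"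
  by (simp_all add: planar_caracol_def)

lemma inner_vertices_G: "inner_vertices G = {2..a + 2}"
  by (auto simp: inner_vertices_def)

lemma caracol_edge_cases:
  assumes "x \<in> caracol_edges \<nu>"
  obtains i k where "x = Upper i k" "1 \<le> i" "i \<le> a" "1 \<le> k" "k \<le> \<nu> ! (i - 1)"
  | i where "x = Axis i" "1 \<le> i" "i \<le> a + 2"
  | i where "x = Lower i" "2 \<le> i" "i \<le> a + 1"
  using assms unfolding caracol_edges_def by auto

lemma in_caracol_edges [simp]:
  "Upper i k \<in> caracol_edges \<nu> \<longleftrightarrow> 1 \<le> i \<and> i \<le> a \<and> 1 \<le> k \<and> k \<le> \<nu> ! (i - 1)"
  "Axis i \<in> caracol_edges \<nu> \<longleftrightarrow> 1 \<le> i \<and> i \<le> a + 2"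
  "Lower i \<in> caracol_edges \<nu> \<longleftrightarrow> 2 \<le> i \<and> i \<le> a + 1"
  by (auto simp: caracol_edges_def)

lemma edge_increasing: "x \<in> caracol_edges \<nu> \<Longrightarrow> 1 \<le> caracol_tail x \<and> caracol_tail x < caracol_head \<nu> x"
  by (erule caracol_edge_cases) auto

text \<open>
  The edges leaving vertex \<open>1\<close> are numbered \<open>0, \<dots>, b\<close> from the bottom to the top of the embedding: the
  axis edge comes first, then the heads increase, and among parallel copies the labels decrease. The
  copy \<open>k\<close> of the edge to \<open>i + 2\<close> has number \<open>m i + 1 - k\<close>. Edge number \<open>p\<close> ends in vertex
  \<open>entry_column p + 2\<close>, also for \<open>p = 0\<close>.
\<close>

definition entry_column :: "nat \<Rightarrow> nat" where
  "entry_column p = (LEAST i. p \<le> m i)"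

definition start :: "nat \<Rightarrow> caracol_edge" where
  "start p = (if p = 0 then Axis 1 else Upper (entry_column p) (Suc (m (entry_column p)) - p))"

text \<open>
  The edges on which a route can leave the axis for the sink, numbered from right to left; number \<open>r\<close>
  starts in vertex \<open>a + 2 - r\<close>. The last axis edge takes the place of the missing lower edge of its
  tail.
\<close>

definition exit :: "nat \<Rightarrow> caracol_edge" where
  "exit r = (if r = 0 then Axis (a + 2) else Lower (a + 2 - r))"

lemma entry_column_le_iff:
  assumes "p \<le> b"
  shows "entry_column p \<le> i \<longleftrightarrow> p \<le> m i"
proof
  have "p \<le> m (entry_column p)" unfolding entry_column_def by (rule LeastI[of _ a]) (simp add: assms)
  also assume "entry_column p \<le> i"
  then have "m (entry_column p) \<le> m i" by (rule partial_sum_mono)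
  finally show "p \<le> m i" .
qed (auto simp: entry_column_def intro: Least_le)

lemma entry_column_le: "p \<le> b \<Longrightarrow> entry_column p \<le> a"
  by (simp add: entry_column_le_iff)

lemma entry_column_0 [simp]: "entry_column 0 = 0"
  using entry_column_le_iff[of 0 0] by simp

lemma entry_column_mono: "p \<le> p' \<Longrightarrow> p' \<le> b \<Longrightarrow> entry_column p \<le> entry_column p'"
  using entry_column_le_iff[of p "entry_column p'"] entry_column_le_iff[of p' "entry_column p'"] by simp

lemma entry_column_pos: "0 < p \<Longrightarrow> p \<le> b \<Longrightarrow> 0 < entry_column p"
  using entry_column_le_iff[of p 0] by auto

lemma entry_column_bounds:
  assumes "0 < p" and "p \<le> b"
  shows "m (entry_column p - 1) < p" and "p \<le> m (entry_column p)"
  using entry_column_le_iff[OF assms(2), of "entry_column p - 1"] entry_column_le_iff[OF assms(2), of "entry_column p"]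
    entry_column_pos[OF assms] by auto

lemma entry_column_eqI:
  assumes "m (i - 1) < p" and "p \<le> m i"
  shows "entry_column p = i"
  unfolding entry_column_def
proof (rule Least_equality)
  fix j assume "p \<le> m j"
  show "i \<le> j"
  proof (rule ccontr)
    assume "\<not> i \<le> j"
    then have "m j \<le> m (i - 1)" by (intro partial_sum_mono) simp
    with \<open>p \<le> m j\<close> assms(1) show False by simp
  qed
qed (rule assms(2))

lemma m_step: "1 \<le> i \<Longrightarrow> i \<le> a \<Longrightarrow> m i = m (i - 1) + \<nu> ! (i - 1)"
  using partial_sum_Suc[of "i - 1" \<nu>] by simp

lemma start_Upper:
  assumes "Upper i k \<in> caracol_edges \<nu>"
  shows "start (Suc (m i) - k) = Upper i k" and "m (i - 1) < Suc (m i) - k" and "Suc (m i) - k \<le> m i"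
proof -
  have ik: "1 \<le> i" "i \<le> a" "1 \<le> k" "k \<le> \<nu> ! (i - 1)" using assms by simp_all
  note step = m_step[OF ik(1,2)]
  show bd: "m (i - 1) < Suc (m i) - k" "Suc (m i) - k \<le> m i" using ik step by linarith+
  then have "entry_column (Suc (m i) - k) = i" by (rule entry_column_eqI)
  then show "start (Suc (m i) - k) = Upper i k" using bd ik step by (simp add: start_def)
qed

lemma start_edge:
  assumes "p \<le> b"
  shows "start p \<in> caracol_edges \<nu>" "caracol_tail (start p) = 1" "caracol_head \<nu> (start p) = entry_column p + 2"
proof -
  have "start p \<in> caracol_edges \<nu> \<and> caracol_tail (start p) = 1 \<and> caracol_head \<nu> (start p) = entry_column p + 2"
  proof (cases "p = 0")
    case True
    then show ?thesis using a_pos by (simp add: start_def)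
  next
    case False
    then have "0 < p" by simp
    note ik = entry_column_bounds[OF this assms] entry_column_pos[OF this assms] entry_column_le[OF assms]
    then have "1 \<le> Suc (m (entry_column p)) - p" "Suc (m (entry_column p)) - p \<le> \<nu> ! (entry_column p - 1)"
      using m_step[of "entry_column p"] by linarith+
    with ik False show ?thesis by (simp add: start_def)
  qed
  then show "start p \<in> caracol_edges \<nu>" "caracol_tail (start p) = 1" "caracol_head \<nu> (start p) = entry_column p + 2"
    by simp_all
qed

lemma inj_start: "inj_on start {..b}"
proof (rule inj_onI)
  fix p p' assume p: "p \<in> {..b}" "p' \<in> {..b}" and eq: "start p = start p'"
  show "p = p'"
  proof (cases "p = 0 \<or> p' = 0")
    case True
    then show ?thesis using eq by (auto simp: start_def split: if_splits)
  next
    case False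
    then have same: "entry_column p = entry_column p'" using eq by (simp add: start_def)
    moreover have "Suc (m (entry_column p)) - p = Suc (m (entry_column p)) - p'"
      using eq False by (simp add: start_def same)
    moreover have "p \<le> m (entry_column p)" "p' \<le> m (entry_column p')" using entry_column_bounds(2) False p by simp_all
    ultimately show ?thesis by simp
  qed
qed

lemma exit_edge:
  assumes "r \<le> a"
  shows "exit r \<in> caracol_edges \<nu>" "caracol_tail (exit r) = a + 2 - r" "caracol_head \<nu> (exit r) = a + 3"
  using assms by (auto simp: exit_def)

lemma inj_exit: "inj_on exit {..a}"
  by (rule inj_onI) (auto simp: exit_def split: if_splits)

lemma start_neq_exit: "start p \<noteq> exit r"
  using a_pos by (auto simp: start_def exit_def)

section \<open>Flows on the caracol graph\<close>

definition conserved :: "real^'e \<Rightarrow> bool" where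
  "conserved z \<longleftrightarrow>
    (\<forall>j\<in>inner_vertices G. (\<Sum>e | tail G e = j. z $ e) = (\<Sum>e | head G e = j. z $ e))"

text \<open>
  The two families of coordinates that serve as marginals of a flow. Padding with \<open>0\<close> makes the marginals
  of a route indicator functions on all numbers.
\<close>

definition entry_flow :: "real^'e \<Rightarrow> nat \<Rightarrow> real" where
  "entry_flow z p = (if p \<le> b then z $ edge (start p) else 0)"

definition exit_flow :: "real^'e \<Rightarrow> nat \<Rightarrow> real" where
  "exit_flow z r = (if r \<le> a then z $ edge (exit r) else 0)"

lemma conserved_sum:
  assumes "\<And>i. i \<in> S \<Longrightarrow> conserved (v i)"
  shows "conserved (\<Sum>i\<in>S. c i *\<^sub>R v i)"
  unfolding conserved_def
proof
  fix j assume j: "j \<in> inner_vertices G"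
  have swap: "(\<Sum>e | Q e. (\<Sum>i\<in>S. c i *\<^sub>R v i) $ e) = (\<Sum>i\<in>S. c i * (\<Sum>e | Q e. v i $ e))" for Q
    by (simp add: sum.swap[of _ S] sum_distrib_left)
  show "(\<Sum>e | tail G e = j. (\<Sum>i\<in>S. c i *\<^sub>R v i) $ e) = (\<Sum>e | head G e = j. (\<Sum>i\<in>S. c i *\<^sub>R v i) $ e)"
    unfolding swap using assms j by (intro sum.cong) (auto simp: conserved_def)
qed

lemma sum_edges: "(\<Sum>e | Q (\<epsilon> e). z $ e) = (\<Sum>x | x \<in> caracol_edges \<nu> \<and> Q x. z $ edge x)"
  by (rule sum.reindex_bij_witness[of _ edge \<epsilon>]) auto

lemma edges_from_source: "{x \<in> caracol_edges \<nu>. caracol_tail x = 1} = start ` {..b}"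
proof
  show "start ` {..b} \<subseteq> {x \<in> caracol_edges \<nu>. caracol_tail x = 1}" using start_edge by auto
  show "{x \<in> caracol_edges \<nu>. caracol_tail x = 1} \<subseteq> start ` {..b}"
  proof
    fix x assume "x \<in> {x \<in> caracol_edges \<nu>. caracol_tail x = 1}"
    then have x: "x \<in> caracol_edges \<nu>" "caracol_tail x = 1" by auto
    from x(1) show "x \<in> start ` {..b}"
    proof (cases rule: caracol_edge_cases)
      case (1 i k)
      have "m i \<le> b" using partial_sum_mono[OF \<open>i \<le> a\<close>, of \<nu>] by simp
      then have "Suc (m i) - k \<le> b" using start_Upper(3)[of i k] x(1) 1(1) by simp
      then show ?thesis using start_Upper(1)[of i k] x(1) 1(1) by (metis atMost_iff imageI)
    next
      case (2 i)
      then have "x = start 0" using x(2) by (simp add: start_def)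
      then show ?thesis by simp
    next
      case (3 i)
      then show ?thesis using x(2) by simp
    qed
  qed
qed

lemma outflow_source: "(\<Sum>e | tail G e = 1. z $ e) = (\<Sum>p\<le>b. entry_flow z p)"
proof -
  have "(\<Sum>e | tail G e = 1. z $ e) = (\<Sum>x\<in>start ` {..b}. z $ edge x)"
    unfolding graph_simps sum_edges[where Q = "\<lambda>x. caracol_tail x = 1"] edges_from_source[symmetric] by simp
  then show ?thesis by (simp add: sum.reindex[OF inj_start] entry_flow_def)
qed

lemma outflow_inner:
  assumes "2 \<le> j" and "j \<le> a + 1"
  shows "(\<Sum>e | tail G e = j. z $ e) = z $ edge (Axis j) + exit_flow z (a + 2 - j)"
proof -
  have "{x \<in> caracol_edges \<nu>. caracol_tail x = j} = {Axis j, Lower j}"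
    using assms by (auto elim!: caracol_edge_cases)
  moreover have "exit (a + 2 - j) = Lower j" using assms by (simp add: exit_def)
  ultimately show ?thesis
    unfolding graph_simps sum_edges[where Q = "\<lambda>x. caracol_tail x = j"] using assms by (simp add: exit_flow_def)
qed

lemma outflow_last: "(\<Sum>e | tail G e = a + 2. z $ e) = exit_flow z 0"
proof -
  have "{x \<in> caracol_edges \<nu>. caracol_tail x = a + 2} = {Axis (a + 2)}"
    by (auto elim!: caracol_edge_cases)
  then show ?thesis
    unfolding graph_simps sum_edges[where Q = "\<lambda>x. caracol_tail x = a + 2"] by (simp add: exit_flow_def exit_def)
qed

lemma inflow_inner:
  assumes "j \<le> a"
  shows "(\<Sum>e | head G e = j + 2. z $ e) =
    z $ edge (Axis (j + 1)) + (\<Sum>p\<in>{m (j - 1)<..m j}. entry_flow z p)"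
proof -
  let ?I = "{m (j - 1)<..m j}"
  have "m j \<le> b" using partial_sum_mono[OF assms, of \<nu>] by simp
  then have sub: "?I \<subseteq> {..b}" by auto
  have "{x \<in> caracol_edges \<nu>. caracol_head \<nu> x = j + 2} = insert (Axis (j + 1)) (start ` ?I)"
  proof (intro equalityI subsetI)
    fix x assume "x \<in> {x \<in> caracol_edges \<nu>. caracol_head \<nu> x = j + 2}"
    then have x: "x \<in> caracol_edges \<nu>" "caracol_head \<nu> x = j + 2" by auto
    from x(1) show "x \<in> insert (Axis (j + 1)) (start ` ?I)"
    proof (cases rule: caracol_edge_cases)
      case (1 i k)
      then have "i = j" using x(2) by simp
      then show ?thesis using start_Upper[of i k] x(1) 1(1)
        by (metis greaterThanAtMost_iff imageI insertI2)
    next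
      case (2 i)
      then show ?thesis using x(2) by simp
    next
      case (3 i)
      then show ?thesis using x(2) assms by simp
    qed
  next
    fix x assume "x \<in> insert (Axis (j + 1)) (start ` ?I)"
    then consider "x = Axis (j + 1)" | p where "x = start p" "p \<in> ?I" by blast
    then show "x \<in> {x \<in> caracol_edges \<nu>. caracol_head \<nu> x = j + 2}"
    proof cases
      case 1
      then show ?thesis using assms by simp
    next
      case 2
      then have "entry_column p = j" by (intro entry_column_eqI) auto
      then show ?thesis using 2 start_edge[of p] sub by auto
    qed
  qed
  moreover have "Axis (j + 1) \<notin> start ` ?I" by (auto simp: start_def)
  moreover have "(\<Sum>x\<in>start ` ?I. z $ edge x) = (\<Sum>p\<in>?I. entry_flow z p)"
    using sub by (subst sum.reindex[OF inj_on_subset[OF inj_start sub]])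
      (auto simp: entry_flow_def intro!: sum.cong)
  ultimately show ?thesis
    unfolding graph_simps sum_edges[where Q = "\<lambda>x. caracol_head \<nu> x = j + 2"] by simp
qed

text \<open>
  The flow on an axis edge is what has entered the axis up to its tail minus what has left it. The last
  column that enters at or before vertex \<open>j + 1\<close> is \<open>m (j - 1)\<close>, where the truncated difference covers
  \<open>j = 0\<close>.
\<close>

lemma axis_flow:
  assumes z: "conserved z" and "j \<le> a"
  shows "z $ edge (Axis (j + 1)) =
    (\<Sum>p\<le>m (j - 1). entry_flow z p) - (\<Sum>r\<in>{a - j<..a}. exit_flow z r)"
  using \<open>j \<le> a\<close>
proof (induction j)
  case 0
  show ?case by (simp add: entry_flow_def start_def)
next
  case (Suc j)
  have IH: "z $ edge (Axis (j + 1)) =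
      (\<Sum>p\<le>m (j - 1). entry_flow z p) - (\<Sum>r\<in>{a - j<..a}. exit_flow z r)"
    using Suc by simp
  have "(\<Sum>e | tail G e = j + 2. z $ e) = (\<Sum>e | head G e = j + 2. z $ e)"
    using z Suc.prems by (simp add: conserved_def inner_vertices_G del: graph_simps)
  then have cons: "z $ edge (Axis (j + 2)) + exit_flow z (a - j) =
      z $ edge (Axis (j + 1)) + (\<Sum>p\<in>{m (j - 1)<..m j}. entry_flow z p)"
    using outflow_inner[of "j + 2" z] inflow_inner[of j z] Suc.prems by simp
  have "{..m j} = {..m (j - 1)} \<union> {m (j - 1)<..m j}" using partial_sum_mono[of "j - 1" j \<nu>] by auto
  then have X: "(\<Sum>p\<le>m j. entry_flow z p) =
      (\<Sum>p\<le>m (j - 1). entry_flow z p) + (\<Sum>p\<in>{m (j - 1)<..m j}. entry_flow z p)"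
    by (simp add: sum.union_disjoint ivl_disj_int)
  have "{a - Suc j<..a} = insert (a - j) {a - j<..a}" using Suc.prems by auto
  then have "(\<Sum>r\<in>{a - Suc j<..a}. exit_flow z r) = exit_flow z (a - j) + (\<Sum>r\<in>{a - j<..a}. exit_flow z r)"
    by simp
  then show ?case using IH cons X by simp
qed

lemma entry_total_eq_exit_total:
  assumes z: "conserved z"
  shows "(\<Sum>p\<le>b. entry_flow z p) = (\<Sum>r\<le>a. exit_flow z r)"
proof -
  have "(\<Sum>e | tail G e = a + 2. z $ e) = (\<Sum>e | head G e = a + 2. z $ e)"
    using z by (simp add: conserved_def inner_vertices_G del: graph_simps)
  then have "exit_flow z 0 = z $ edge (Axis (a + 1)) + (\<Sum>p\<in>{m (a - 1)<..b}. entry_flow z p)"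
    using outflow_last[of z] inflow_inner[of a z] by simp
  moreover have "{..b} = {..m (a - 1)} \<union> {m (a - 1)<..b}" using partial_sum_mono[of "a - 1" a \<nu>] by auto
  then have "(\<Sum>p\<le>b. entry_flow z p) =
      (\<Sum>p\<le>m (a - 1). entry_flow z p) + (\<Sum>p\<in>{m (a - 1)<..b}. entry_flow z p)"
    by (simp add: sum.union_disjoint ivl_disj_int)
  moreover have "{..a} = insert 0 {0<..a}" by auto
  then have "(\<Sum>r\<le>a. exit_flow z r) = exit_flow z 0 + (\<Sum>r\<in>{0<..a}. exit_flow z r)" by simp
  ultimately show ?thesis using axis_flow[OF z, of a] by simp
qed

lemma conserved_eqI:
  assumes "conserved z" and "conserved z'"
    and entry: "\<And>p. p \<le> b \<Longrightarrow> entry_flow z p = entry_flow z' p"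
    and exit: "\<And>r. r \<le> a \<Longrightarrow> exit_flow z r = exit_flow z' r"
  shows "z = z'"
proof -
  have ee: "entry_flow z = entry_flow z'" "exit_flow z = exit_flow z'"
    using entry exit by (auto simp: fun_eq_iff) (auto simp: entry_flow_def exit_flow_def)
  have "z $ edge x = z' $ edge x" if "x \<in> caracol_edges \<nu>" for x
    using that
  proof (cases rule: caracol_edge_cases)
    case (1 i k)
    then have "x \<in> start ` {..b}" unfolding edges_from_source[symmetric] using that by simp
    then show ?thesis using entry by (auto simp: entry_flow_def)
  next
    case (2 i)
    show ?thesis
    proof (cases "i = a + 2")
      case True
      then show ?thesis using exit[of 0] 2 by (simp add: exit_flow_def exit_def)
    next
      case False
      then show ?thesis
        using 2 axis_flow[OF assms(1), of "i - 1"] axis_flow[OF assms(2), of "i - 1"] by (simp add: ee)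
    qed
  next
    case (3 i)
    then have "exit (a + 2 - i) = x" by (simp add: exit_def)
    then show ?thesis using exit[of "a + 2 - i"] 3 by (simp add: exit_flow_def)
  qed
  then have "z $ e = z' $ e" for e using \<epsilon>_in[of e] by (metis edge_\<epsilon>)
  then show ?thesis by (simp add: vec_eq_iff)
qed

lemma linear_entry_flow: "linear (\<lambda>z. entry_flow z p)" and linear_exit_flow: "linear (\<lambda>z. exit_flow z r)"
  by (auto simp: entry_flow_def exit_flow_def intro!: linearI)

lemma flow_polytope_iff:
  "z \<in> flow_polytope G \<longleftrightarrow> (\<forall>e. 0 \<le> z $ e) \<and> (\<Sum>p\<le>b. entry_flow z p) = 1 \<and> conserved z"
  unfolding flow_polytope_def outflow_source conserved_def by blast

text \<open>
  The difference of the two sides is the flow on an axis edge, so nonnegativity on the axis is what confines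
  the staircases to the Young diagram of \<open>\<Lambda>\<close>.
\<close>

lemma exit_flow_dominated:
  assumes "z \<in> flow_polytope G" and "k < a"
  shows "(\<Sum>r\<in>{k<..a}. exit_flow z r) \<le> (\<Sum>p\<le>\<Lambda> k. entry_flow z p)"
proof -
  have "conserved z" "0 \<le> z $ edge (Axis (a - k + 1))" using assms by (auto simp: flow_polytope_iff)
  then show ?thesis using axis_flow[of z "a - k"] \<open>k < a\<close> by (simp add: path_partition_eq)
qed

section \<open>Routes as grid points\<close>

text \<open>
  The parts of a route from, respectively up to, an axis vertex \<open>i\<close>.
\<close>

definition axis_then_exit :: "nat \<Rightarrow> nat \<Rightarrow> caracol_edge list" where
  "axis_then_exit i r = map Axis [i..<a + 2 - r] @ [exit r]"

definition entry_path :: "nat \<Rightarrow> nat \<Rightarrow> caracol_edge list" where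
  "entry_path p i = start p # map Axis [entry_column p + 2..<i]"

definition route :: "nat \<times> nat \<Rightarrow> 'e list" where
  "route c = map edge (start (fst c) # axis_then_exit (entry_column (fst c) + 2) (snd c))"

abbreviation grid :: "(nat \<times> nat) set" where
  "grid \<equiv> region a b \<Lambda>"

text \<open>
  A route has to enter the axis at or before the vertex at which it leaves it. In terms of the numbers
  of its two end edges this is membership in the region of \<open>\<Lambda>\<close>, since \<open>\<Lambda> k\<close> is the number of the last
  edge from vertex \<open>1\<close> that ends at or before \<open>a + 1 - k\<close>, the vertex of exit \<open>k + 1\<close>.
\<close>

lemma grid_iff: "(p, r) \<in> grid \<longleftrightarrow> p \<le> b \<and> r \<le> a \<and> entry_column p + 2 \<le> a + 2 - r"
proof -
  have "p \<le> shelf b \<Lambda> r \<longleftrightarrow> p \<le> b \<and> entry_column p \<le> a - r" if "r \<le> a"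
  proof (cases r)
    case 0
    then show ?thesis using entry_column_le by auto
  next
    case (Suc k)
    then have "shelf b \<Lambda> r = m (a - r)" using that by (simp add: path_partition_eq)
    moreover have "m (a - r) \<le> b" using partial_sum_mono[of "a - r" a \<nu>] by simp
    ultimately show ?thesis using entry_column_le_iff[of p "a - r"] by auto
  qed
  then show ?thesis by (auto simp: region_def)
qed

lemma set_axis_then_exit: "set (axis_then_exit i r) = Axis ` {i..<a + 2 - r} \<union> {exit r}"
  by (auto simp: axis_then_exit_def)

lemma set_route_edges:
  assumes "(p, r) \<in> grid"
  shows "set (start p # axis_then_exit (entry_column p + 2) r) \<subseteq> caracol_edges \<nu>"
  using assms start_edge exit_edge by (auto simp: grid_iff set_axis_then_exit)

lemma dipath_axis_then_exit:
  assumes "r \<le> a" and "2 \<le> i" and "i \<le> a + 2 - r"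
  shows "dipath G i (map edge (axis_then_exit i r)) (a + 3)"
  using assms(3) assms(2)
proof (induction i rule: inc_induct)
  case base
  then show ?case using exit_edge[OF \<open>r \<le> a\<close>] by (simp add: axis_then_exit_def)
next
  case (step i)
  then have "axis_then_exit i r = Axis i # axis_then_exit (Suc i) r"
    by (simp add: axis_then_exit_def upt_conv_Cons)
  then show ?case using step by simp
qed

lemma route_in_routes:
  assumes "c \<in> grid"
  shows "route c \<in> routes G"
proof -
  obtain p r where c: "c = (p, r)" by (cases c)
  then show ?thesis
    using assms start_edge[of p] dipath_axis_then_exit[of r "entry_column p + 2"]
    by (simp add: routes_def route_def grid_iff)
qed

lemma dipath_to_sink_cases:
  assumes "dipath G i (map edge xs) (a + 3)" and "2 \<le> i" and "i \<le> a + 2" and "set xs \<subseteq> caracol_edges \<nu>"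
  obtains r where "r \<le> a" "i \<le> a + 2 - r" "xs = axis_then_exit i r"
proof -
  have "\<exists>r\<le>a. i \<le> a + 2 - r \<and> xs = axis_then_exit i r"
    using assms
  proof (induction xs arbitrary: i)
    case Nil
    then show ?case by simp
  next
    case (Cons x xs)
    have x: "x \<in> caracol_edges \<nu>" "caracol_tail x = i" using Cons.prems by auto
    have rest: "dipath G (caracol_head \<nu> x) (map edge xs) (a + 3)" "set xs \<subseteq> caracol_edges \<nu>"
      using Cons.prems x(1) by auto
    have at_sink: "xs = []" if "caracol_head \<nu> x = a + 3"
    proof (rule ccontr)
      assume "xs \<noteq> []"
      then obtain y ys where y: "xs = y # ys" by (cases xs) auto
      then have "y \<in> caracol_edges \<nu>" "caracol_tail y = a + 3" using rest that by auto
      then show False by (auto elim!: caracol_edge_cases)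
    qed
    from x(1) show ?case
    proof (cases rule: caracol_edge_cases)
      case (1 k l)
      then show ?thesis using x(2) Cons.prems by simp
    next
      case (2 k)
      then have x': "x = Axis i" using x(2) by simp
      show ?thesis
      proof (cases "i = a + 2")
        case True
        then have "x # xs = axis_then_exit i 0" using at_sink x' by (simp add: axis_then_exit_def exit_def)
        then show ?thesis using True by auto
      next
        case False
        then obtain r where "r \<le> a" "Suc i \<le> a + 2 - r" "xs = axis_then_exit (Suc i) r"
          using Cons.IH[of "Suc i"] rest x' Cons.prems by auto
        then have "x # xs = axis_then_exit i r" by (simp add: x' axis_then_exit_def upt_conv_Cons)
        then show ?thesis using \<open>r \<le> a\<close> \<open>Suc i \<le> a + 2 - r\<close> by auto
      qed
    next
      case (3 k)
      then have x': "x = Lower i" "i \<le> a + 1" using x(2) by simp_all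
      then have "x # xs = axis_then_exit i (a + 2 - i)"
        using at_sink Cons.prems by (simp add: axis_then_exit_def exit_def)
      then show ?thesis using x' Cons.prems by (intro exI[of _ "a + 2 - i"]) auto
    qed
  qed
  then show thesis using that by blast
qed

lemma routes_eq: "routes G = route ` grid"
proof
  show "route ` grid \<subseteq> routes G" using route_in_routes by blast
  show "routes G \<subseteq> route ` grid"
  proof
    fix R assume "R \<in> routes G"
    then have R: "dipath G 1 R (a + 3)" by (simp add: routes_def)
    define xs where "xs = map \<epsilon> R"
    have Rxs: "R = map edge xs" and xs: "set xs \<subseteq> caracol_edges \<nu>" by (auto simp: xs_def comp_def)
    from R Rxs obtain x ys where x: "xs = x # ys" by (cases xs) auto
    have "x \<in> caracol_edges \<nu>" "caracol_tail x = 1" using R Rxs x xs by auto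
    then obtain p where p: "p \<le> b" "x = start p" using edges_from_source by auto
    note sp = start_edge[OF p(1)]
    have "dipath G (entry_column p + 2) (map edge ys) (a + 3)" using R Rxs x p sp by simp
    then obtain r where r: "r \<le> a" "entry_column p + 2 \<le> a + 2 - r" "ys = axis_then_exit (entry_column p + 2) r"
      using dipath_to_sink_cases[of "entry_column p + 2" ys] entry_column_le[OF p(1)] xs x by auto
    then have "R = route (p, r)" using Rxs x p by (simp add: route_def)
    moreover have "(p, r) \<in> grid" using p r by (simp add: grid_iff)
    ultimately show "R \<in> route ` grid" by blast
  qed
qed

definition route_vec :: "nat \<times> nat \<Rightarrow> real^'e" where
  "route_vec c = indicator_vec (route c)"

lemma route_vec_edge:
  assumes "c \<in> grid" and "x \<in> caracol_edges \<nu>"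
  shows "route_vec c $ edge x =
    of_bool (x \<in> set (start (fst c) # axis_then_exit (entry_column (fst c) + 2) (snd c)))"
proof -
  obtain p r where c: "c = (p, r)" by (cases c)
  have "edge x \<in> set (route c) \<longleftrightarrow> x \<in> set (start p # axis_then_exit (entry_column p + 2) r)"
    unfolding route_def c fst_conv snd_conv set_map
    by (rule inj_on_image_mem_iff[OF inj_edge assms(2)]) (use set_route_edges assms(1) c in simp)
  then show ?thesis by (simp add: route_vec_def indicator_vec_def c)
qed

lemma entry_flow_route:
  assumes "c \<in> grid"
  shows "entry_flow (route_vec c) = (\<lambda>p. if p = fst c then 1 else 0)"
proof
  fix p
  obtain q r where c: "c = (q, r)" by (cases c)
  show "entry_flow (route_vec c) p = (if p = fst c then 1 else 0)"
  proof (cases "p \<le> b")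
    case True
    have "q \<le> b" using assms c by (simp add: grid_iff)
    have "start p \<in> set (start q # axis_then_exit (entry_column q + 2) r) \<longleftrightarrow> start p = start q"
      using start_neq_exit[of p r] by (auto simp: set_axis_then_exit start_def)
    also have "\<dots> \<longleftrightarrow> p = q" using inj_start True \<open>q \<le> b\<close> by (auto dest: inj_onD)
    finally show ?thesis
      using True route_vec_edge[OF assms start_edge(1)[OF True]] c by (simp add: entry_flow_def)
  next
    case False
    then show ?thesis using assms c by (auto simp: entry_flow_def grid_iff)
  qed
qed

lemma exit_flow_route:
  assumes "c \<in> grid"
  shows "exit_flow (route_vec c) = (\<lambda>r. if r = snd c then 1 else 0)"
proof
  fix s
  obtain q r where c: "c = (q, r)" by (cases c)
  show "exit_flow (route_vec c) s = (if s = snd c then 1 else 0)"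
  proof (cases "s \<le> a")
    case True
    have "r \<le> a" using assms c by (simp add: grid_iff)
    have "exit s \<in> set (start q # axis_then_exit (entry_column q + 2) r) \<longleftrightarrow> exit s = exit r"
      using start_neq_exit[of q s] by (auto simp: set_axis_then_exit exit_def)
    also have "\<dots> \<longleftrightarrow> s = r" using inj_exit True \<open>r \<le> a\<close> by (auto dest: inj_onD)
    finally show ?thesis
      using True route_vec_edge[OF assms exit_edge(1)[OF True]] c by (simp add: exit_flow_def)
  next
    case False
    then show ?thesis using assms c by (auto simp: exit_flow_def grid_iff)
  qed
qed

lemma inj_route_vec: "inj_on route_vec grid"
proof (rule inj_onI)
  fix c d assume cd: "c \<in> grid" "d \<in> grid" "route_vec c = route_vec d"
  have "fst c = fst d" using entry_flow_route[OF cd(1)] entry_flow_route[OF cd(2)] cd(3)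
    by (metis zero_neq_one)
  moreover have "snd c = snd d" using exit_flow_route[OF cd(1)] exit_flow_route[OF cd(2)] cd(3)
    by (metis zero_neq_one)
  ultimately show "c = d" by (rule prod_eqI)
qed

lemma inj_route: "inj_on route grid"
  using inj_route_vec by (auto simp: inj_on_def route_vec_def)

lemma route_vec_in_flow_polytope:
  assumes "c \<in> grid"
  shows "route_vec c \<in> flow_polytope G"
  unfolding route_vec_def
  using edge_increasing[OF \<epsilon>_in] route_in_routes[OF assms] by (intro route_in_flow_polytope) simp_all

section \<open>Coherence and maximal cliques\<close>

lemma route_split:
  assumes "(p, r) \<in> grid" and "entry_column p + 2 \<le> i" and "i \<le> a + 2 - r"
  shows "path_to G i (route (p, r)) = map edge (entry_path p i)"
    and "path_from G i (route (p, r)) = map edge (axis_then_exit i r)"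
proof -
  have pr: "p \<le> b" "r \<le> a" using assms(1) by (simp_all add: grid_iff)
  have "[entry_column p + 2..<a + 2 - r] = [entry_column p + 2..<i] @ [i..<a + 2 - r]"
    using assms(2,3) by (intro upt_split)
  then have route: "route (p, r) = map edge (entry_path p i) @ map edge (axis_then_exit i r)"
    by (simp add: route_def entry_path_def axis_then_exit_def)
  have before: "head G e \<le> i" if "e \<in> set (map edge (entry_path p i))" for e
    using that start_edge[OF pr(1)] assms(2,3) by (auto simp: entry_path_def)
  have hd: "\<not> head G (hd (map edge (axis_then_exit i r))) \<le> i"
  proof (cases "i = a + 2 - r")
    case True
    then show ?thesis using exit_edge[OF pr(2)] by (simp add: axis_then_exit_def)
  next
    case False
    then have "i < a + 2 - r" using assms(3) by simp
    moreover from this have "axis_then_exit i r = Axis i # axis_then_exit (Suc i) r"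
      by (simp add: axis_then_exit_def upt_conv_Cons)
    ultimately show ?thesis using assms(2) by simp
  qed
  have ne: "map edge (axis_then_exit i r) \<noteq> []" by (simp add: axis_then_exit_def)
  have "takeWhile (\<lambda>e. head G e \<le> i) (map edge (axis_then_exit i r)) = []"
    and "dropWhile (\<lambda>e. head G e \<le> i) (map edge (axis_then_exit i r)) = map edge (axis_then_exit i r)"
    using hd ne by (cases "map edge (axis_then_exit i r)"; simp)+
  moreover have "takeWhile (\<lambda>e. head G e \<le> i) (route (p, r)) =
      map edge (entry_path p i) @ takeWhile (\<lambda>e. head G e \<le> i) (map edge (axis_then_exit i r))"
    unfolding route by (rule takeWhile_append2) (rule before)
  moreover have "dropWhile (\<lambda>e. head G e \<le> i) (route (p, r)) =
      dropWhile (\<lambda>e. head G e \<le> i) (map edge (axis_then_exit i r))"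
    unfolding route by (rule dropWhile_append2) (rule before)
  ultimately show "path_to G i (route (p, r)) = map edge (entry_path p i)"
    and "path_from G i (route (p, r)) = map edge (axis_then_exit i r)"
    by (simp_all only: path_to_def path_from_def append_Nil2)
qed

lemma passes_through_route:
  assumes "(p, r) \<in> grid" and "2 \<le> i" and "i \<le> a + 2"
  shows "passes_through G (route (p, r)) i \<longleftrightarrow> entry_column p + 2 \<le> i \<and> i \<le> a + 2 - r"
proof -
  let ?xs = "start p # axis_then_exit (entry_column p + 2) r"
  have pr: "p \<le> b" "r \<le> a" "entry_column p + 2 \<le> a + 2 - r" using assms(1) by (simp_all add: grid_iff)
  have sub: "\<And>x. x \<in> set ?xs \<Longrightarrow> \<epsilon> (edge x) = x" using set_route_edges[OF assms(1)] by auto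
  have "tail G ` set (route (p, r)) = caracol_tail ` set ?xs"
    "head G ` set (route (p, r)) = caracol_head \<nu> ` set ?xs"
    unfolding route_def fst_conv snd_conv set_map image_image graph_simps
    using sub by (auto intro!: image_cong simp del: set_simps)
  then have "passes_through G (route (p, r)) i \<longleftrightarrow>
      i \<in> caracol_tail ` set ?xs \<or> i \<in> caracol_head \<nu> ` set ?xs"
    by (simp only: passes_through_def Un_iff)
  also have "caracol_tail ` set ?xs = {1} \<union> {entry_column p + 2..a + 2 - r}"
    using start_edge[OF pr(1)] exit_edge[OF pr(2)] pr(3) by (auto simp: set_axis_then_exit image_image)
  also have "caracol_head \<nu> ` set ?xs = {entry_column p + 2..a + 2 - r} \<union> {a + 3}"
  proof -
    have "insert (entry_column p + 2) (Suc ` {entry_column p + 2..<a + 2 - r}) = {entry_column p + 2..a + 2 - r}"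
      using pr(3) by (auto simp: image_Suc_atLeastLessThan)
    then show ?thesis using start_edge[OF pr(1)] exit_edge[OF pr(2)]
      by (auto simp: set_axis_then_exit image_image)
  qed
  finally show ?thesis using assms(2,3) by auto
qed

text \<open>
  At the vertex where two incoming paths merge, an upper edge precedes the axis edge and smaller labels come
  first, so the path whose first edge has the larger number is the smaller one.
\<close>

lemma incoming_path_less_iff:
  assumes p: "p \<le> b" "entry_column p + 2 \<le> i" and q: "q \<le> b" "entry_column q + 2 \<le> i" and "i \<le> a + 2"
  shows "incoming_path_less G (map edge (entry_path p i)) (map edge (entry_path q i)) \<longleftrightarrow> q < p"
proof
  assume "incoming_path_less G (map edge (entry_path p i)) (map edge (entry_path q i))"
  then obtain e f where "e \<in> set (map edge (entry_path p i))" "f \<in> set (map edge (entry_path q i))"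
    and less: "in_less G (head G e) e f"
    unfolding incoming_path_less_def by (metis in_set_conv_decomp)
  then obtain x y where x: "e = edge x" "x \<in> set (entry_path p i)" and y: "f = edge y" "y \<in> set (entry_path q i)"
    by auto
  have mem: "x \<in> caracol_edges \<nu>" "y \<in> caracol_edges \<nu>"
    using x y start_edge(1) p q \<open>i \<le> a + 2\<close> by (auto simp: entry_path_def)
  then have less': "planar_in_less (caracol_head \<nu> x) x y" using less x(1) y(1) by simp
  then obtain j k where xU: "x = Upper j k" by (cases x; cases y) auto
  then have xs: "x = start p" using x(2) by (auto simp: entry_path_def)
  with xU have p0: "p \<noteq> 0" by (auto simp: start_def split: if_splits)
  have col: "entry_column p = j" using xs xU p0 by (simp add: start_def)
  show "q < p"
  proof (cases y)
    case (Upper j' l)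
    then have jl: "j' = j" "k < l" using less' xU by auto
    have ys: "y = start q" using y(2) Upper by (auto simp: entry_path_def)
    with Upper have q0: "q \<noteq> 0" by (auto simp: start_def split: if_splits)
    have "l = Suc (m j) - q" "k = Suc (m j) - p"
      using xs ys xU Upper jl p0 q0 by (auto simp: start_def)
    then show ?thesis using jl by linarith
  next
    case (Axis l)
    then have l: "l = j + 1" using less' xU by simp
    have "entry_column q < j"
    proof (cases "y = start q")
      case True
      then have "q = 0" "l = 1" using Axis by (auto simp: start_def split: if_splits)
      then show ?thesis using entry_column_pos[of p] p0 p(1) col by simp
    next
      case False
      then show ?thesis using y(2) Axis l by (auto simp: entry_path_def)
    qed
    then show ?thesis using entry_column_mono[of p q] q(1) col by (meson leD not_le)
  next
    case (Lower l)
    then show ?thesis using less' xU by simp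
  qed
next
  assume "q < p"
  then have p0: "p \<noteq> 0" and cle: "entry_column q \<le> entry_column p" using entry_column_mono p(1) by auto
  let ?j = "entry_column p" and ?S = "map edge (map Axis [entry_column p + 2..<i])"
  note sp = start_edge[OF p(1)] and sq = start_edge[OF q(1)]
  have hp: "head G (edge (start p)) = ?j + 2" using sp by simp
  show "incoming_path_less G (map edge (entry_path p i)) (map edge (entry_path q i))"
  proof (cases "entry_column q = ?j")
    case True
    have q0: "q \<noteq> 0"
    proof
      assume "q = 0"
      with True entry_column_pos[of p] p0 p(1) show False by simp
    qed
    have ne: "start p \<noteq> start q" using inj_start \<open>q < p\<close> p(1) q(1) by (auto dest: inj_onD)
    have bd: "p \<le> m ?j" using entry_column_bounds(2)[of p] p0 p(1) by simp
    have "planar_in_less (?j + 2) (start p) (start q)"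
      using True p0 q0 \<open>q < p\<close> bd by (auto simp: start_def)
    then have "map edge (entry_path p i) = [] @ edge (start p) # ?S \<and>
        map edge (entry_path q i) = [] @ edge (start q) # ?S \<and> edge (start p) \<noteq> edge (start q) \<and>
        head G (edge (start p)) = head G (edge (start q)) \<and>
        in_less G (head G (edge (start p))) (edge (start p)) (edge (start q))"
      using sp sq True ne inj_on_eq_iff[OF inj_edge sp(1) sq(1)] by (simp add: entry_path_def)
    then show ?thesis unfolding incoming_path_less_def by blast
  next
    case False
    then have lt: "entry_column q < ?j" using cle by simp
    let ?f = "Axis (?j + 1)"
    have f: "?f \<in> caracol_edges \<nu>" using p(2) \<open>i \<le> a + 2\<close> by simp
    have "[entry_column q + 2..<i] = [entry_column q + 2..<?j + 1] @ (?j + 1) # [?j + 2..<i]"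
    proof -
      have "[entry_column q + 2..<i] = [entry_column q + 2..<?j + 1] @ [?j + 1..<i]"
        using lt p(2) by (intro upt_split) auto
      then show ?thesis using p(2) by (simp add: upt_conv_Cons)
    qed
    then have "map edge (entry_path q i) =
        (edge (start q) # map edge (map Axis [entry_column q + 2..<?j + 1])) @ edge ?f # ?S"
      by (simp add: entry_path_def)
    moreover have "map edge (entry_path p i) = [] @ edge (start p) # ?S" by (simp add: entry_path_def)
    moreover have "start p \<noteq> ?f" using p0 by (simp add: start_def)
    then have "edge (start p) \<noteq> edge ?f" using inj_on_eq_iff[OF inj_edge sp(1) f] by simp
    moreover have "head G (edge (start p)) = head G (edge ?f)" using hp f by simp
    moreover have "in_less G (head G (edge (start p))) (edge (start p)) (edge ?f)"
      using sp f p0 by (simp add: start_def)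
    ultimately show ?thesis unfolding incoming_path_less_def by blast
  qed
qed

text \<open>
  Two outgoing paths separate where the first of them leaves the axis, and the one that stays on it is the
  smaller one.
\<close>

lemma outgoing_path_less_iff:
  assumes r: "r \<le> a" "i \<le> a + 2 - r" and s: "s \<le> a" "i \<le> a + 2 - s" and "2 \<le> i"
  shows "outgoing_path_less G (map edge (axis_then_exit i r)) (map edge (axis_then_exit i s)) \<longleftrightarrow> r < s"
proof
  assume "outgoing_path_less G (map edge (axis_then_exit i r)) (map edge (axis_then_exit i s))"
  then obtain e f where "e \<in> set (map edge (axis_then_exit i r))" "f \<in> set (map edge (axis_then_exit i s))"
    and less: "out_less G (tail G e) e f"
    unfolding outgoing_path_less_def by (metis in_set_conv_decomp)
  then obtain x y where x: "e = edge x" "x \<in> set (axis_then_exit i r)" and y: "f = edge y" "y \<in> set (axis_then_exit i s)"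
    by auto
  have mem: "x \<in> caracol_edges \<nu>" "y \<in> caracol_edges \<nu>"
    using x y exit_edge(1) r s \<open>2 \<le> i\<close> by (auto simp: set_axis_then_exit)
  then have "planar_out_less (caracol_tail x) x y" using less x(1) y(1) by simp
  then obtain j where xy: "x = Axis j" "y = Lower j" by (cases x; cases y) auto
  then have j: "j = a + 2 - s" "0 < s" using y(2) by (auto simp: set_axis_then_exit exit_def split: if_splits)
  then have "j < a + 2 - r" using x(2) xy by (auto simp: set_axis_then_exit exit_def split: if_splits)
  then show "r < s" using j by linarith
next
  assume "r < s"
  let ?w = "a + 2 - s"
  have w: "i \<le> ?w" "?w < a + 2 - r" "2 \<le> ?w" "?w \<le> a + 1" using s \<open>r < s\<close> by auto
  have "[i..<a + 2 - r] = [i..<?w] @ [?w..<a + 2 - r]"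
    using w by (intro upt_split) auto
  also have "[?w..<a + 2 - r] = ?w # [Suc ?w..<a + 2 - r]" using w by (simp add: upt_conv_Cons)
  finally have "map edge (axis_then_exit i r) =
      map edge (map Axis [i..<?w]) @ edge (Axis ?w) # map edge (axis_then_exit (Suc ?w) r)"
    by (simp add: axis_then_exit_def)
  moreover have "map edge (axis_then_exit i s) = map edge (map Axis [i..<?w]) @ edge (Lower ?w) # []"
    using \<open>r < s\<close> by (simp add: axis_then_exit_def exit_def)
  moreover have mem: "Axis ?w \<in> caracol_edges \<nu>" "Lower ?w \<in> caracol_edges \<nu>" using w by simp_all
  then have "edge (Axis ?w) \<noteq> edge (Lower ?w)" using inj_on_eq_iff[OF inj_edge mem] by simp
  moreover have "tail G (edge (Axis ?w)) = tail G (edge (Lower ?w))"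
    "out_less G (tail G (edge (Axis ?w))) (edge (Axis ?w)) (edge (Lower ?w))"
    using mem by simp_all
  ultimately show "outgoing_path_less G (map edge (axis_then_exit i r)) (map edge (axis_then_exit i s))"
    unfolding outgoing_path_less_def by blast
qed

text \<open>
  At each common vertex the order of the incoming parts reverses the order of the columns and that of
  the outgoing parts agrees with the order of the rows, so the conflict is the same at all of
  them.
\<close>

lemma coherent_iff:
  assumes "c \<in> grid" and "d \<in> grid"
  shows "coherent G (route c) (route d) \<longleftrightarrow> \<not> crossing c d \<and> \<not> crossing d c"
proof -
  obtain p r q s where cd: "c = (p, r)" "d = (q, s)" by (cases c, cases d)
  have g: "(p, r) \<in> grid" "(q, s) \<in> grid" using assms cd by simp_all
  then have bd: "p \<le> b" "r \<le> a" "q \<le> b" "s \<le> a"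
    "entry_column p + 2 \<le> a + 2 - r" "entry_column q + 2 \<le> a + 2 - s" by (simp_all add: grid_iff)
  have local: "coherent_at G i (route c) (route d) \<longleftrightarrow> \<not> crossing c d \<and> \<not> crossing d c"
    if i: "entry_column p + 2 \<le> i" "i \<le> a + 2 - r" "entry_column q + 2 \<le> i" "i \<le> a + 2 - s" for i
  proof -
    have i': "i \<le> a + 2" "2 \<le> i" using i by linarith+
    show ?thesis
      unfolding coherent_at_def cd crossing_def fst_conv snd_conv route_split[OF g(1) i(1,2)] route_split[OF g(2) i(3,4)]
        incoming_path_less_iff[OF bd(1) i(1) bd(3) i(3) i'(1)] incoming_path_less_iff[OF bd(3) i(3) bd(1) i(1) i'(1)]
        outgoing_path_less_iff[OF bd(2) i(2) bd(4) i(4) i'(2)] outgoing_path_less_iff[OF bd(4) i(4) bd(2) i(2) i'(2)]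
      by blast
  qed
  have common: "passes_through G (route c) i \<and> passes_through G (route d) i \<longleftrightarrow>
      entry_column p + 2 \<le> i \<and> i \<le> a + 2 - r \<and> entry_column q + 2 \<le> i \<and> i \<le> a + 2 - s"
    if "i \<in> inner_vertices G" for i
    using passes_through_route[OF g(1), of i] passes_through_route[OF g(2), of i] that
    unfolding cd inner_vertices_G by auto
  show ?thesis
  proof
    assume coh: "coherent G (route c) (route d)"
    show "\<not> crossing c d \<and> \<not> crossing d c"
    proof (rule ccontr)
      assume neg: "\<not> ?thesis"
      \<comment> \<open>Crossing routes share the vertex at which the later of the two enters the axis.\<close>
      then have "entry_column p + 2 \<le> a + 2 - s \<and> entry_column q + 2 \<le> a + 2 - r"
        using bd entry_column_mono[of p q] entry_column_mono[of q p] by (auto simp: cd crossing_def)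
      then obtain i where i: "entry_column p + 2 \<le> i" "i \<le> a + 2 - r" "entry_column q + 2 \<le> i" "i \<le> a + 2 - s"
        using bd by (meson le_cases)
      then have "i \<in> inner_vertices G" by (auto simp: inner_vertices_G)
      then have "coherent_at G i (route c) (route d)" using coh common i unfolding coherent_def by blast
      then show False using local[OF i] neg by blast
    qed
  next
    assume "\<not> crossing c d \<and> \<not> crossing d c"
    then show "coherent G (route c) (route d)" unfolding coherent_def using common local by blast
  qed
qed

lemma clique_iff: "clique G C \<longleftrightarrow> (\<exists>D\<subseteq>grid. noncrossing D \<and> C = route ` D)"
proof
  assume C: "clique G C"
  then obtain D where D: "D \<subseteq> grid" "C = route ` D"
    unfolding clique_def routes_eq by (meson subset_imageE)
  have "noncrossing D"
    unfolding noncrossing_def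
  proof (intro ballI)
    fix c d assume cd: "c \<in> D" "d \<in> D"
    then have "coherent G (route c) (route d)" using C D(2) by (simp add: clique_def)
    then show "\<not> crossing c d" using coherent_iff[of c d] cd D(1) by blast
  qed
  then show "\<exists>D\<subseteq>grid. noncrossing D \<and> C = route ` D" using D by blast
next
  assume "\<exists>D\<subseteq>grid. noncrossing D \<and> C = route ` D"
  then obtain D where D: "D \<subseteq> grid" "noncrossing D" "C = route ` D" by blast
  have "coherent G (route c) (route d)" if "c \<in> D" "d \<in> D" for c d
    using coherent_iff[of c d] that D(1,2) unfolding noncrossing_def by blast
  then show "clique G C" using D(1) unfolding clique_def routes_eq D(3) by blast
qed

definition ideal :: "(nat \<Rightarrow> nat) set" where
  "ideal = {q \<in> partitions. q \<le> \<Lambda>}"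

lemma ideal_box_bounded: "q \<in> ideal \<Longrightarrow> box_bounded a b q"
  using box_bounded_mono[OF path_partition_box_bounded] by (simp add: ideal_def)

abbreviation stair :: "(nat \<Rightarrow> nat) \<Rightarrow> (nat \<times> nat) set" where
  "stair \<equiv> staircase a b"

lemma stair_subset_grid: "q \<in> ideal \<Longrightarrow> stair q \<subseteq> grid"
  by (simp add: ideal_def staircase_subset_region)

lemma maximal_clique_iff: "maximal_clique G C \<longleftrightarrow> (\<exists>q\<in>ideal. C = route ` stair q)"
proof -
  have image_eq: "route ` D = route ` D' \<longleftrightarrow> D = D'" "route ` D \<subseteq> route ` D' \<longleftrightarrow> D \<subseteq> D'"
    if "D \<subseteq> grid" "D' \<subseteq> grid" for D D'
    using that inj_on_image_eq_iff[OF inj_route] inj_on_image_subset_iff[OF inj_route] by auto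
  have "maximal_clique G C \<longleftrightarrow> (\<exists>D. C = route ` D \<and> D \<subseteq> grid \<and> noncrossing D \<and>
      (\<forall>D'. D' \<subseteq> grid \<and> noncrossing D' \<and> D \<subseteq> D' \<longrightarrow> D' = D))"
  proof
    assume C: "maximal_clique G C"
    then obtain D where D: "D \<subseteq> grid" "noncrossing D" "C = route ` D"
      by (auto simp: maximal_clique_def clique_iff)
    have "D' = D" if "D' \<subseteq> grid" "noncrossing D'" "D \<subseteq> D'" for D'
    proof -
      have "clique G (route ` D')" "C \<subseteq> route ` D'" using that D by (auto simp: clique_iff)
      then have "route ` D' = C" using C by (auto simp: maximal_clique_def)
      then show ?thesis using image_eq(1) that D by blast
    qed
    then show "\<exists>D. C = route ` D \<and> D \<subseteq> grid \<and> noncrossing D \<and>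
      (\<forall>D'. D' \<subseteq> grid \<and> noncrossing D' \<and> D \<subseteq> D' \<longrightarrow> D' = D)" using D by blast
  next
    assume "\<exists>D. C = route ` D \<and> D \<subseteq> grid \<and> noncrossing D \<and>
      (\<forall>D'. D' \<subseteq> grid \<and> noncrossing D' \<and> D \<subseteq> D' \<longrightarrow> D' = D)"
    then obtain D where D: "C = route ` D" "D \<subseteq> grid" "noncrossing D"
      "\<And>D'. D' \<subseteq> grid \<Longrightarrow> noncrossing D' \<Longrightarrow> D \<subseteq> D' \<Longrightarrow> D' = D" by blast
    show "maximal_clique G C"
      unfolding maximal_clique_def
    proof (intro conjI allI impI)
      show "clique G C" unfolding clique_iff using D(1,2,3) by blast
      fix E assume E: "clique G E \<and> C \<subseteq> E"
      then obtain D' where D': "D' \<subseteq> grid" "noncrossing D'" "E = route ` D'" by (auto simp: clique_iff)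
      then have "D \<subseteq> D'" using E D(1) image_eq(2)[OF D(2) D'(1)] by simp
      then have "D' = D" by (rule D(4)[OF D'(1,2)])
      then show "E = C" using D'(3) D(1) by simp
    qed
  qed
  also have "\<dots> \<longleftrightarrow> (\<exists>q\<in>ideal. C = route ` stair q)"
    unfolding maximal_noncrossing_iff[OF path_partition_box_bounded] ideal_def by blast
  finally show ?thesis .
qed

section \<open>Cells of the planar triangulation\<close>

abbreviation "flow_mass q z \<equiv> mass a b q (entry_flow z) (exit_flow z)"

lemma route_vec_conserved: "c \<in> grid \<Longrightarrow> conserved (route_vec c)"
  using route_vec_in_flow_polytope flow_polytope_iff by blast

text \<open>
  Both sides are conserved and have the same flow on the edges at the two ends of the routes, which
  determines a flow.
\<close>

lemma staircase_expansion:
  assumes q: "q \<in> ideal" and z: "conserved z"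
  shows "z = (\<Sum>c\<in>stair q. flow_mass q z c *\<^sub>R route_vec c)"
proof (rule conserved_eqI[OF z])
  note bq = ideal_box_bounded[OF q]
  have grid: "c \<in> grid" if "c \<in> stair q" for c using that stair_subset_grid[OF q] by blast
  let ?s = "\<Sum>c\<in>stair q. flow_mass q z c *\<^sub>R route_vec c"
  show "conserved ?s" using grid route_vec_conserved by (intro conserved_sum) blast
  fix p assume "p \<le> b"
  have "entry_flow ?s p = (\<Sum>c\<in>stair q. flow_mass q z c * entry_flow (route_vec c) p)"
    by (simp add: linear_sum[OF linear_entry_flow] linear_cmul[OF linear_entry_flow])
  also have "\<dots> = (\<Sum>c\<in>stair q. flow_mass q z c * (if p = fst c then 1 else 0))"
    using grid by (intro sum.cong) (auto simp: entry_flow_route)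
  also have "\<dots> = (\<Sum>i\<le>b. entry_flow z i * (if p = i then 1 else 0))"
    by (rule mass_staircase_sum(2)[OF bq entry_total_eq_exit_total[OF z]])
  also have "\<dots> = entry_flow z p" using \<open>p \<le> b\<close> by (simp add: if_distrib[of "(*) _"] cong: if_cong)
  finally show "entry_flow z p = entry_flow ?s p" ..
next
  note bq = ideal_box_bounded[OF q]
  have grid: "c \<in> grid" if "c \<in> stair q" for c using that stair_subset_grid[OF q] by blast
  let ?s = "\<Sum>c\<in>stair q. flow_mass q z c *\<^sub>R route_vec c"
  fix r assume "r \<le> a"
  have "exit_flow ?s r = (\<Sum>c\<in>stair q. flow_mass q z c * exit_flow (route_vec c) r)"
    by (simp add: linear_sum[OF linear_exit_flow] linear_cmul[OF linear_exit_flow])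
  also have "\<dots> = (\<Sum>c\<in>stair q. flow_mass q z c * (if r = snd c then 1 else 0))"
    using grid by (intro sum.cong) (auto simp: exit_flow_route)
  also have "\<dots> = (\<Sum>i\<le>a. exit_flow z i * (if r = i then 1 else 0))"
    by (rule mass_staircase_sum(1)[OF bq])
  also have "\<dots> = exit_flow z r" using \<open>r \<le> a\<close> by (simp add: if_distrib[of "(*) _"] cong: if_cong)
  finally show "exit_flow z r = exit_flow ?s r" ..
qed

lemma flow_mass_total:
  assumes "q \<in> ideal" and "conserved z"
  shows "(\<Sum>c\<in>stair q. flow_mass q z c) = (\<Sum>p\<le>b. entry_flow z p)"
  using mass_staircase_sum(2)[OF ideal_box_bounded[OF assms(1)] entry_total_eq_exit_total[OF assms(2)], where f = "\<lambda>_. 1"]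
  by simp

lemma flow_mass_route_vec:
  assumes "q \<in> ideal" and "c \<in> stair q" and "d \<in> stair q"
  shows "flow_mass q (route_vec d) c = (if c = d then 1 else 0)"
  using mass_point[OF ideal_box_bounded[OF assms(1)] assms(2,3)] stair_subset_grid[OF assms(1)] assms(3)
  by (auto simp: entry_flow_route exit_flow_route)

lemma linear_flow_mass: "linear (\<lambda>z. flow_mass q z c)"
  by (intro linear_mass linear_entry_flow linear_exit_flow)

lemma inj_route_vec_stair: "q \<in> ideal \<Longrightarrow> inj_on route_vec (stair q)"
  using inj_on_subset[OF inj_route_vec stair_subset_grid] .

lemma sum_route_vec_image:
  "q \<in> ideal \<Longrightarrow> (\<Sum>v\<in>route_vec ` stair q. f v) = (\<Sum>c\<in>stair q. f (route_vec c))"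
  by (simp add: sum.reindex[OF inj_route_vec_stair])

text \<open>
  The masses are linear functionals dual to the routes of the cell.
\<close>

lemma stair_independent:
  assumes q: "q \<in> ideal"
  shows "\<not> affine_dependent (route_vec ` stair q)"
proof
  assume "affine_dependent (route_vec ` stair q)"
  then obtain U c where U: "(\<Sum>v\<in>route_vec ` stair q. U v *\<^sub>R v) = 0"
    and c: "c \<in> stair q" "U (route_vec c) \<noteq> 0"
    using affine_dependent_explicit_finite[of "route_vec ` stair q"] finite_staircase by auto
  let ?f = "\<lambda>z. flow_mass q z c"
  note lin = linear_flow_mass[of q c]
  have "0 = ?f (\<Sum>d\<in>stair q. U (route_vec d) *\<^sub>R route_vec d)"
    using U linear_0[OF lin] by (simp add: sum_route_vec_image[OF q])
  also have "\<dots> = (\<Sum>d\<in>stair q. U (route_vec d) * ?f (route_vec d))"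
    by (simp add: linear_sum[OF lin] linear_cmul[OF lin])
  also have "\<dots> = (\<Sum>d\<in>stair q. U (route_vec d) * (if c = d then 1 else 0))"
    using flow_mass_route_vec[OF q c(1)] by (intro sum.cong) auto
  also have "\<dots> = U (route_vec c)"
    using c(1) finite_staircase by (simp add: if_distrib[of "(*) _"] cong: if_cong)
  finally show False using c(2) by simp
qed

text \<open>
  A quadratic function with value \<open>p * r\<close> at the route of the grid point \<open>(p, r)\<close>. Uncrossing two routes
  strictly lowers the sum of the heights, so the lower faces can only be spanned by coherent routes.
\<close>

definition height :: "real^'e \<Rightarrow> real" where
  "height z = (\<Sum>p\<le>b. real p * entry_flow z p) * (\<Sum>r\<le>a. real r * exit_flow z r)"

lemma sum_entry_route:
  assumes "c \<in> grid"
  shows "(\<Sum>p\<le>b. f p * entry_flow (route_vec c) p) = f (fst c)"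
  using assms by (cases c) (simp add: entry_flow_route grid_iff if_distrib[of "(*) _"] cong: if_cong)

lemma sum_exit_route:
  assumes "c \<in> grid"
  shows "(\<Sum>r\<le>a. f r * exit_flow (route_vec c) r) = f (snd c)"
  using assms by (cases c) (simp add: exit_flow_route grid_iff if_distrib[of "(*) _"] cong: if_cong)

text \<open>
  Young's inequality bounds \<open>p * r\<close> from below by a function of \<open>r\<close> plus a function of \<open>p\<close>. On routes
  such a sum is the value of a linear function, with coefficients on the two families of end edges.
\<close>

lemma stair_contact_set:
  assumes q: "q \<in> ideal"
  shows "\<exists>c d. contact_set (route_vec ` grid) height c d (route_vec ` stair q)"
proof -
  note bq = ideal_box_bounded[OF q]
  define u where "u p = - real (\<Sum>k<a. q k - p)" for p
  define v where "v r = real (\<Sum>k<r. q k)" for r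
  define f where "f z = (\<Sum>p\<le>b. u p * entry_flow z p) + (\<Sum>r\<le>a. v r * exit_flow z r)" for z
  have "linear f"
    unfolding f_def
    by (rule linearI)
      (simp_all add: linear_add[OF linear_entry_flow] linear_cmul[OF linear_entry_flow]
        linear_add[OF linear_exit_flow] linear_cmul[OF linear_exit_flow]
        algebra_simps sum.distrib sum_distrib_left)
  then obtain w where w: "\<And>z. w \<bullet> z = f z" using linear_functional_eq_inner by blast
  have val: "w \<bullet> route_vec c - 0 = real (\<Sum>k<snd c. q k) - real (\<Sum>k<a. q k - fst c)"
    "height (route_vec c) = real (fst c * snd c)" if "c \<in> grid" for c
  proof -
    have "f (route_vec c) = u (fst c) + v (snd c)"
      using that by (simp add: f_def sum_entry_route sum_exit_route)
    then show "w \<bullet> route_vec c - 0 = real (\<Sum>k<snd c. q k) - real (\<Sum>k<a. q k - fst c)"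
      by (simp add: w u_def v_def)
    show "height (route_vec c) = real (fst c * snd c)"
      using that by (simp add: height_def sum_entry_route sum_exit_route)
  qed
  have young: "w \<bullet> route_vec c - 0 \<le> height (route_vec c)"
    "w \<bullet> route_vec c - 0 = height (route_vec c) \<longleftrightarrow> c \<in> stair q" if c: "c \<in> grid" for c
  proof -
    have bd: "snd c \<le> a" "fst c \<le> b" using c by (cases c; simp add: grid_iff)+
    have *: "real x - real y \<le> real w \<longleftrightarrow> x \<le> w + y" "real x - real y = real w \<longleftrightarrow> x = w + y" for x y w
      by linarith+
    show "w \<bullet> route_vec c - 0 \<le> height (route_vec c)"
      unfolding val[OF c] * by (rule young_inequality(1)[OF bq bd])
    show "w \<bullet> route_vec c - 0 = height (route_vec c) \<longleftrightarrow> c \<in> stair q"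
      unfolding val[OF c] * using young_inequality(2)[OF bq bd] by simp
  qed
  have "contact_set (route_vec ` grid) height w 0 (route_vec ` stair q)"
    unfolding contact_set_def
  proof (intro conjI ballI)
    show "\<And>x. x \<in> route_vec ` grid \<Longrightarrow> w \<bullet> x - 0 \<le> height x" using young(1) by blast
    show "route_vec ` stair q = {x \<in> route_vec ` grid. w \<bullet> x - 0 = height x}"
      using young(2) stair_subset_grid[OF q] by blast
  qed
  then show ?thesis by blast
qed

abbreviation "P \<equiv> flow_polytope G"
abbreviation "cell q \<equiv> convex hull (route_vec ` stair q)"

definition unit_flows :: "(real^'e) set" where
  "unit_flows = {z. conserved z \<and> (\<Sum>p\<le>b. entry_flow z p) = 1}"

lemma affine_unit_flows: "affine unit_flows"
  unfolding affine_def
proof (intro ballI allI impI)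
  fix x y u v assume xy: "x \<in> unit_flows" "y \<in> unit_flows" "u + v = (1::real)"
  let ?w = "\<lambda>i. if i then u else v" and ?z = "\<lambda>i. if i then x else y"
  have "conserved (\<Sum>i\<in>UNIV. ?w i *\<^sub>R ?z i)"
    using xy by (intro conserved_sum) (auto simp: unit_flows_def)
  then have "conserved (u *\<^sub>R x + v *\<^sub>R y)" by (simp add: UNIV_bool add.commute)
  moreover have "(\<Sum>p\<le>b. entry_flow (u *\<^sub>R x + v *\<^sub>R y) p) =
      u * (\<Sum>p\<le>b. entry_flow x p) + v * (\<Sum>p\<le>b. entry_flow y p)"
    by (simp add: linear_add[OF linear_entry_flow] linear_cmul[OF linear_entry_flow] sum.distrib sum_distrib_left)
  ultimately show "u *\<^sub>R x + v *\<^sub>R y \<in> unit_flows" using xy by (simp add: unit_flows_def)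
qed

lemma flow_polytope_eq_nonneg: "P = {z. \<forall>e. 0 \<le> z $ e} \<inter> unit_flows"
  by (auto simp: flow_polytope_iff unit_flows_def)

lemma convex_flow_polytope: "convex P"
proof -
  have "convex {z :: real^'e. \<forall>e. 0 \<le> z $ e}" by (auto simp: convex_def)
  then show ?thesis
    unfolding flow_polytope_eq_nonneg using affine_imp_convex[OF affine_unit_flows] by (rule convex_Int)
qed

text \<open>
  The staircase of the quantiles of the two marginals has nonnegative masses, so the expansion along it is
  a convex combination.
\<close>

lemma cells_cover:
  assumes "z \<in> P"
  obtains q where "q \<in> ideal" "z \<in> cell q"
proof -
  have z: "\<And>e. 0 \<le> z $ e" "(\<Sum>p\<le>b. entry_flow z p) = 1" "conserved z"
    using assms by (auto simp: flow_polytope_iff)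
  obtain q where q: "q \<in> partitions" "q \<le> \<Lambda>" "\<And>c. c \<in> stair q \<Longrightarrow> 0 \<le> flow_mass q z c"
  proof (rule mass_nonneg_staircase[OF path_partition_box_bounded])
    show "0 \<le> entry_flow z i" "0 \<le> exit_flow z i" for i using z(1) by (simp_all add: entry_flow_def exit_flow_def)
    show "(\<Sum>i\<le>b. entry_flow z i) = (\<Sum>s\<le>a. exit_flow z s)" using entry_total_eq_exit_total[OF z(3)] .
    show "(\<Sum>s\<in>{k<..a}. exit_flow z s) \<le> (\<Sum>i\<le>\<Lambda> k. entry_flow z i)" if "k < a" for k
      using exit_flow_dominated[OF assms that] .
  qed blast
  then have qi: "q \<in> ideal" by (simp add: ideal_def)
  have "(\<Sum>c\<in>stair q. flow_mass q z c *\<^sub>R route_vec c) \<in> cell q"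
  proof (rule convex_sum[OF finite_staircase convex_convex_hull])
    show "(\<Sum>c\<in>stair q. flow_mass q z c) = 1" using flow_mass_total[OF qi z(3)] z(2) by simp
    show "\<And>c. c \<in> stair q \<Longrightarrow> 0 \<le> flow_mass q z c" by (rule q(3))
    show "\<And>c. c \<in> stair q \<Longrightarrow> route_vec c \<in> cell q" by (intro hull_inc) simp
  qed
  then have "z \<in> cell q" using staircase_expansion[OF qi z(3)] by simp
  with qi show thesis by (rule that)
qed

lemma flow_polytope_eq_hull: "P = convex hull (route_vec ` grid)"
proof
  show "convex hull (route_vec ` grid) \<subseteq> P"
    using route_vec_in_flow_polytope convex_flow_polytope by (intro hull_minimal) auto
  show "P \<subseteq> convex hull (route_vec ` grid)"
  proof
    fix z assume "z \<in> P"
    then obtain q where "q \<in> ideal" "z \<in> cell q" by (rule cells_cover)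
    moreover from this have "cell q \<subseteq> convex hull (route_vec ` grid)"
      by (intro hull_mono image_mono stair_subset_grid)
    ultimately show "z \<in> convex hull (route_vec ` grid)" by blast
  qed
qed

lemma clique_simplex_route: "clique_simplex (route ` S) = convex hull (route_vec ` S)"
  by (simp add: clique_simplex_def image_image route_vec_def)

lemma clique_simplices_eq: "{clique_simplex C | C. maximal_clique G C} = cell ` ideal"
proof -
  have "{clique_simplex C | C. maximal_clique G C} = clique_simplex ` (\<lambda>q. route ` stair q) ` ideal"
    unfolding maximal_clique_iff by blast
  then show ?thesis by (simp add: image_image clique_simplex_route)
qed

lemma framed_triangulation_eq:
  "framed_triangulation G = {F. \<exists>S\<in>(\<lambda>q. route_vec ` stair q) ` ideal. F face_of convex hull S}"
proof -
  have "framed_triangulation G = {F. \<exists>S\<in>{clique_simplex C | C. maximal_clique G C}. F face_of S}"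
    unfolding framed_triangulation_def by blast
  then show ?thesis unfolding clique_simplices_eq by auto
qed

lemma finite_grid: "finite grid"
proof -
  have "grid \<subseteq> {..b} \<times> {..a}" by (auto simp: grid_iff)
  then show ?thesis by (rule finite_subset) simp
qed

lemma grid_covered: "(\<Union>q\<in>ideal. stair q) = grid"
proof
  show "(\<Union>q\<in>ideal. stair q) \<subseteq> grid" using stair_subset_grid by blast
  show "grid \<subseteq> (\<Union>q\<in>ideal. stair q)"
  proof
    fix c assume "c \<in> grid"
    then have "{c} \<subseteq> grid" "noncrossing {c}" by (auto simp: noncrossing_def crossing_def)
    then obtain q where "q \<in> partitions" "q \<le> \<Lambda>" "{c} \<subseteq> stair q"
      by (rule noncrossing_subset_staircase[OF path_partition_box_bounded])
    then show "c \<in> (\<Union>q\<in>ideal. stair q)" by (auto simp: ideal_def)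
  qed
qed

lemma ideal_nonempty: "ideal \<noteq> {}"
  using box_bounded_partition[OF path_partition_box_bounded] by (auto simp: ideal_def)

lemma planar_triangulation: "triangulation_of (framed_triangulation G) P"
  and planar_regular: "regular_triangulation (framed_triangulation G)"
proof -
  let ?M = "(\<lambda>q. route_vec ` stair q) ` ideal"
  have fin: "finite (route_vec ` grid)" using finite_grid by simp
  have union: "\<Union>?M = route_vec ` grid" unfolding grid_covered[symmetric] by blast
  have ne: "?M \<noteq> {}" using ideal_nonempty by simp
  have ind: "\<And>S. S \<in> ?M \<Longrightarrow> \<not> affine_dependent S" using stair_independent by blast
  have sup: "\<And>S. S \<in> ?M \<Longrightarrow> \<exists>c d. contact_set (route_vec ` grid) height c d S" using stair_contact_set by blast
  have cov: "convex hull (route_vec ` grid) \<subseteq> (\<Union>S\<in>?M. convex hull S)"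
  proof
    fix z assume "z \<in> convex hull (route_vec ` grid)"
    then have "z \<in> P" unfolding flow_polytope_eq_hull .
    then obtain q where "q \<in> ideal" "z \<in> cell q" by (rule cells_cover)
    then show "z \<in> (\<Union>S\<in>?M. convex hull S)" by auto
  qed
  show "triangulation_of (framed_triangulation G) P"
    unfolding framed_triangulation_eq flow_polytope_eq_hull
    by (rule supported_cells_triangulation[OF fin union ne ind sup cov])
  show "regular_triangulation (framed_triangulation G)"
    unfolding framed_triangulation_eq
    by (rule supported_cells_regular[OF fin union ne ind sup cov])
qed

text \<open>
  The expansion of a unit flow along any one staircase has coefficients with sum \<open>1\<close>, so the vertices of a
  single cell already span all unit flows.
\<close>

lemma affine_hull_stair:
  assumes q: "q \<in> ideal"
  shows "affine hull (route_vec ` stair q) = unit_flows" and "affine hull P = unit_flows"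
proof -
  let ?V = "route_vec ` stair q"
  have "unit_flows \<subseteq> affine hull ?V"
  proof
    fix z assume "z \<in> unit_flows"
    then have z: "conserved z" "(\<Sum>p\<le>b. entry_flow z p) = 1" by (simp_all add: unit_flows_def)
    define w where "w v = flow_mass q z (inv_into (stair q) route_vec v)" for v
    have w: "w (route_vec c) = flow_mass q z c" if "c \<in> stair q" for c
      using that by (simp add: w_def inv_into_f_f[OF inj_route_vec_stair[OF q]])
    have "(\<Sum>v\<in>?V. w v) = 1" "(\<Sum>v\<in>?V. w v *\<^sub>R v) = z"
      using flow_mass_total[OF q z(1)] staircase_expansion[OF q z(1)] z(2)
      by (simp_all add: sum_route_vec_image[OF q] w cong: sum.cong)
    then show "z \<in> affine hull ?V"
      using finite_staircase by (auto simp: affine_hull_finite)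
  qed
  moreover have "affine hull ?V \<subseteq> affine hull P"
    using route_vec_in_flow_polytope stair_subset_grid[OF q] by (intro hull_mono) auto
  moreover have "affine hull P \<subseteq> unit_flows"
    using affine_unit_flows by (intro hull_minimal) (auto simp: flow_polytope_eq_nonneg)
  ultimately show "affine hull ?V = unit_flows" "affine hull P = unit_flows" by auto
qed

lemma cell_aff_dim: "q \<in> ideal \<Longrightarrow> aff_dim (cell q) = aff_dim P"
  using affine_hull_stair[of q] by (metis aff_dim_affine_hull affine_hull_convex_hull)

lemma top_simplices_planar: "top_simplices (framed_triangulation G) P = cell ` ideal"
proof
  show "cell ` ideal \<subseteq> top_simplices (framed_triangulation G) P"
  proof
    fix S assume "S \<in> cell ` ideal"
    then obtain q where q: "q \<in> ideal" "S = cell q" by blast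
    then have "S face_of cell q" by (simp add: face_of_refl)
    then show "S \<in> top_simplices (framed_triangulation G) P"
      using q cell_aff_dim by (auto simp: top_simplices_def framed_triangulation_eq)
  qed
  show "top_simplices (framed_triangulation G) P \<subseteq> cell ` ideal"
  proof
    fix S assume S: "S \<in> top_simplices (framed_triangulation G) P"
    then obtain q where q: "q \<in> ideal" "S face_of cell q"
      by (auto simp: top_simplices_def framed_triangulation_eq)
    have "aff_dim S = aff_dim (cell q)" using S cell_aff_dim[OF q(1)] by (simp add: top_simplices_def)
    then have "S = cell q" using face_of_aff_dim_lt[OF convex_convex_hull q(2)] by force
    then show "S \<in> cell ` ideal" using q(1) by blast
  qed
qed

text \<open>
  The masses of an integral flow are differences of partial sums of its coordinates, hence integers.
\<close>

lemma cell_unimodular: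
  assumes q: "q \<in> ideal"
  shows "unimodular_simplex (integer_points \<inter> affine hull P) (cell q)"
  unfolding unimodular_simplex_def
proof (intro exI conjI)
  let ?V = "route_vec ` stair q"
  show fin: "finite ?V" using finite_staircase by simp
  show "\<not> affine_dependent ?V" by (rule stair_independent[OF q])
  show "integer_points \<inter> affine hull P = {\<Sum>v\<in>?V. of_int (c v) *\<^sub>R v | c :: real^'e \<Rightarrow> int. (\<Sum>v\<in>?V. c v) = 1}"
    (is "?L = ?R")
  proof
    show "?L \<subseteq> ?R"
    proof
      fix z assume "z \<in> ?L"
      then have z: "conserved z" "(\<Sum>p\<le>b. entry_flow z p) = 1" and int: "\<And>e. z $ e \<in> \<int>"
        using affine_hull_stair(2)[OF q] by (auto simp: unit_flows_def integer_points_def)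
      define w where "w v = \<lfloor>flow_mass q z (inv_into (stair q) route_vec v)\<rfloor>" for v
      have "flow_mass q z c \<in> \<int>" for c
        using int by (intro mass_Ints) (simp_all add: entry_flow_def exit_flow_def)
      then have w: "real_of_int (w (route_vec c)) = flow_mass q z c" if "c \<in> stair q" for c
        using that by (simp add: w_def inv_into_f_f[OF inj_route_vec_stair[OF q]])
      have "(\<Sum>v\<in>?V. real_of_int (w v)) = 1" "(\<Sum>v\<in>?V. of_int (w v) *\<^sub>R v) = z"
        using flow_mass_total[OF q z(1)] staircase_expansion[OF q z(1)] z(2)
        by (simp_all add: sum_route_vec_image[OF q] w cong: sum.cong)
      moreover from this(1) have "(\<Sum>v\<in>?V. w v) = 1" by (metis of_int_1 of_int_eq_iff of_int_sum)
      ultimately show "z \<in> ?R" by blast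
    qed
    show "?R \<subseteq> ?L"
    proof
      fix z assume "z \<in> ?R"
      then obtain c :: "real^'e \<Rightarrow> int" where c: "z = (\<Sum>v\<in>?V. of_int (c v) *\<^sub>R v)" "(\<Sum>v\<in>?V. c v) = 1"
        by blast
      have "(\<Sum>v\<in>?V. real_of_int (c v)) = 1" using c(2) by (metis of_int_1 of_int_sum)
      then have "z \<in> affine hull ?V" using c(1) fin by (auto simp: affine_hull_finite)
      then have "z \<in> affine hull P" using affine_hull_stair[OF q] by simp
      moreover have "v $ e \<in> \<int>" if "v \<in> ?V" for v e
        using that by (auto simp: route_vec_def indicator_vec_def)
      then have "z \<in> integer_points" by (auto simp: integer_points_def c(1) intro!: Ints_sum Ints_mult)
      ultimately show "z \<in> ?L" by blast
    qed
  qed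
qed simp

lemma planar_unimodular: "unimodular_triangulation (framed_triangulation G) P"
  unfolding unimodular_triangulation_def top_simplices_planar using cell_unimodular by blast

section \<open>The dual graph\<close>

lemma card_stair:
  assumes q: "q \<in> ideal"
  shows "2 \<le> card (route_vec ` stair q)"
proof -
  note bq = ideal_box_bounded[OF q]
  have "(0, a) \<in> stair q" using box_bounded_zero[OF bq, of a] by (simp add: staircase_def)
  moreover have "(b, 0) \<in> stair q" using box_bounded_le[OF bq, of 0] by (simp add: staircase_def)
  ultimately have "card {(0, a), (b, 0)} \<le> card (stair q)"
    using finite_staircase by (intro card_mono) auto
  then show ?thesis using a_pos by (simp add: card_image[OF inj_route_vec_stair[OF q]])
qed

lemma cell_eq_iff:
  assumes "q \<in> ideal" and "q' \<in> ideal"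
  shows "cell q = cell q' \<longleftrightarrow> q = q'"
proof
  assume "cell q = cell q'"
  then have "route_vec ` stair q = route_vec ` stair q'"
    by (rule convex_hull_eq_imp_eq[OF stair_independent[OF assms(1)] stair_independent[OF assms(2)]])
  then have "stair q = stair q'"
    using inj_on_image_eq_iff[OF inj_route_vec stair_subset_grid[OF assms(1)] stair_subset_grid[OF assms(2)]] by simp
  then show "q = q'"
    using staircase_subset_imp_eq[OF ideal_box_bounded[OF assms(1)] ideal_box_bounded[OF assms(2)]] by simp
qed simp

lemma cells_adjacent_iff:
  assumes "q \<in> ideal" and "q' \<in> ideal" and "q \<noteq> q'"
  shows "(\<exists>F. F facet_of cell q \<and> F facet_of cell q') \<longleftrightarrow> young_cover q q' \<or> young_cover q' q"
proof -
  note sub = stair_subset_grid[OF assms(1)] stair_subset_grid[OF assms(2)]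
  have remove: "route_vec ` stair q - {route_vec c} = route_vec ` stair q' - {route_vec d} \<longleftrightarrow>
      stair q - {c} = stair q' - {d}" if "c \<in> stair q" "d \<in> stair q'" for c d
  proof -
    have "route_vec ` stair q - {route_vec c} = route_vec ` (stair q - {c})"
      using inj_on_image_set_diff[OF inj_route_vec_stair[OF assms(1)], of "stair q" "{c}"] that by simp
    moreover have "route_vec ` stair q' - {route_vec d} = route_vec ` (stair q' - {d})"
      using inj_on_image_set_diff[OF inj_route_vec_stair[OF assms(2)], of "stair q'" "{d}"] that by simp
    moreover have "stair q - {c} \<subseteq> grid" "stair q' - {d} \<subseteq> grid" using sub by auto
    ultimately show ?thesis using inj_on_image_eq_iff[OF inj_route_vec] by simp
  qed
  have "(\<exists>F. F facet_of cell q \<and> F facet_of cell q') \<longleftrightarrow>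
      (\<exists>c\<in>stair q. \<exists>d\<in>stair q'. stair q - {c} = stair q' - {d})"
    unfolding shared_facet_iff[OF stair_independent[OF assms(1)] card_stair[OF assms(1)]
        stair_independent[OF assms(2)] card_stair[OF assms(2)]]
    using remove by simp
  then show ?thesis
    using staircases_adjacent_iff[OF ideal_box_bounded[OF assms(1)] ideal_box_bounded[OF assms(2)] assms(3)]
    by simp
qed

lemma dual_graph_planar:
  "ugraph_iso (dual_graph (framed_triangulation G) P) (hasse_diagram (young_ideal \<Lambda>))"
proof (rule ugraph_iso_of_inverse)
  have I: "young_ideal \<Lambda> = ideal"
    using young_ideal_eq[OF box_bounded_partition[OF path_partition_box_bounded]] by (simp add: ideal_def)
  show "bij_betw cell (fst (hasse_diagram (young_ideal \<Lambda>))) (fst (dual_graph (framed_triangulation G) P))"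
    using cell_eq_iff
    by (auto simp: bij_betw_def inj_on_def hasse_diagram_def dual_graph_def I top_simplices_planar)
  show "\<And>e. e \<in> snd (hasse_diagram (young_ideal \<Lambda>)) \<Longrightarrow> e \<subseteq> fst (hasse_diagram (young_ideal \<Lambda>))"
    by (auto simp: hasse_diagram_def)
  show "(`) cell ` snd (hasse_diagram (young_ideal \<Lambda>)) = snd (dual_graph (framed_triangulation G) P)"
    unfolding hasse_diagram_def dual_graph_def I top_simplices_planar snd_conv
  proof (intro equalityI subsetI)
    fix E assume "E \<in> (`) cell ` {{p, q} | p q. p \<in> ideal \<and> q \<in> ideal \<and> young_cover p q}"
    then obtain p q where pq: "p \<in> ideal" "q \<in> ideal" "young_cover p q" "E = {cell p, cell q}" by auto
    then have "p \<noteq> q" using young_cover_irrefl by blast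
    then have "cell p \<noteq> cell q" "\<exists>F. F facet_of cell p \<and> F facet_of cell q"
      using cell_eq_iff[OF pq(1,2)] cells_adjacent_iff[OF pq(1,2)] pq(3) by blast+
    then show "E \<in> {{S, S'} | S S'. S \<in> cell ` ideal \<and> S' \<in> cell ` ideal \<and> S \<noteq> S' \<and>
        (\<exists>F. F facet_of S \<and> F facet_of S')}" using pq by blast
  next
    fix E assume "E \<in> {{S, S'} | S S'. S \<in> cell ` ideal \<and> S' \<in> cell ` ideal \<and> S \<noteq> S' \<and>
        (\<exists>F. F facet_of S \<and> F facet_of S')}"
    then obtain p q where pq: "p \<in> ideal" "q \<in> ideal" "E = {cell p, cell q}" "cell p \<noteq> cell q"
      "\<exists>F. F facet_of cell p \<and> F facet_of cell q" by blast
    then have "p \<noteq> q" by blast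
    then have "young_cover p q \<or> young_cover q p" using cells_adjacent_iff[OF pq(1,2)] pq(5) by simp
    then have "\<exists>p' q'. {p, q} = {p', q'} \<and> p' \<in> ideal \<and> q' \<in> ideal \<and> young_cover p' q'"
    proof
      assume "young_cover p q"
      then show ?thesis using pq(1,2) by (intro exI[of _ p] exI[of _ q]) simp
    next
      assume "young_cover q p"
      then show ?thesis using pq(1,2) by (intro exI[of _ q] exI[of _ p]) (simp add: insert_commute)
    qed
    then have "{p, q} \<in> {{p, q} | p q. p \<in> ideal \<and> q \<in> ideal \<and> young_cover p q}" by simp
    moreover have "E = cell ` {p, q}" using pq(3) by simp
    ultimately show "E \<in> (`) cell ` {{p, q} | p q. p \<in> ideal \<and> q \<in> ideal \<and> young_cover p q}"
      by (rule image_eqI[rotated])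
  qed
qed

end

theorem theorem1p3:
  fixes a b :: nat and \<nu> :: "nat list" and \<epsilon> :: "'e::finite \<Rightarrow> caracol_edge"
    and G :: "'e framed_graph" and P :: "(real^'e) set" and T :: "(real^'e) set set"
  assumes "a \<ge> 1" and "length \<nu> = a" and "sum_list \<nu> = b"
    and "bij_betw \<epsilon> UNIV (caracol_edges \<nu>)"
  defines "G \<equiv> planar_caracol \<nu> \<epsilon>"
  defines "P \<equiv> flow_polytope G"
  defines "T \<equiv> framed_triangulation G"
  shows "triangulation_of T P \<and>
    top_simplices T P = {clique_simplex C | C. maximal_clique G C} \<and>
    regular_triangulation T \<and>
    unimodular_triangulation T P \<and>
    ugraph_iso (dual_graph T P) (hasse_diagram (young_ideal (path_partition \<nu>)))"
proof -
  interpret caracol \<nu> \<epsilon>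
    using assms(1,2,4) by unfold_locales auto
  show ?thesis
    unfolding T_def P_def G_def
    using planar_triangulation top_simplices_planar clique_simplices_eq planar_regular
      planar_unimodular dual_graph_planar by simp
qed

end
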